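(* Let $\mathbf U\subset\mathbb R^d$ be a closed convex set with nonempty interior, and let $X:(\Omega,\mathcal A,\mathbb P)\to\mathbb R^d$ be a square integrable random vector whose distribution $\mu$ has support contained in $\mathbf U$. Let $\Gamma^{(0)}\subset\mathbf U$ with $|\Gamma^{(0)}|=N$, let $(\Gamma^{(k)})_{k\ge0}$ be the Lloyd iterates started at $\Gamma^{(0)}$, and let $(x^{(k)})_{k\ge0}$ be a consistent representation of them. Assume that the sequence $(\Gamma^{(k)})_{k\ge0}$ is bounded. (a) If $\mu$ assigns no mass to hyperplanes and $\operatorname{supp}(\mu)=\mathbf U$, then $$\liminf_k\ \min_{i\ne j}\big|x_i^{(k)}-x_j^{(k)}\big|>0 .$$ (b) Let $\Gamma^{(\infty)}$ be a limiting grid of $(\Gamma^{(k)})_{k\ge0}$. If the boundaries of the Voronoi cells of $\Gamma^{(\infty)}$ are $\mu$-negligible, i.e. $\mathbb P\big(X\in\bigcup_i\partial C_i(\Gamma^{(\infty)})\big)=0$, then $\Gamma^{(\infty)}$ is stationary, i.e. it is a fixed point of the Lloyd map. Moreover, if $\Gamma^{(\varphi(k))}\to\Gamma^{(\infty)}$ along a subsequence $\varphi$, then $$\widehat X^{\Gamma^{(\varphi(k))}}\longrightarrow\widehat X^{\Gamma^{(\infty)}}\quad\text{a.s. and in }L^2(\mathbb P)\text{ as }k\to+\infty .$$ (c) If $\mu$ assigns no mass to hyperplanes, then $\nabla\mathcal G(x^{(k)})\to0$ as $k\to+\infty$. (d) If $\mu$ has a convex support with $\mathbf U=\operatorname{supp}(\mu)$,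 then $$\sum_{k\ge0}\big|x^{(k+1)}-x^{(k)}\big|^2_{(\mathbb R^d)^N}<+\infty .$$ In particular $x^{(k+1)}-x^{(k)}\to0$ as $k\to+\infty$. Hence the set $\mathcal X_\infty$ of limits in $(\mathbb R^d)^N$ of subsequences of $(x^{(k)})_{k\ge0}$ is a compact connected subset of $\mathbf U^N$.
   Context: $|\cdot|$ is the canonical Euclidean norm on $\mathbb R^d$; $|A|$ also denotes the cardinality of a finite set $A$; $|x|^2_{(\mathbb R^d)^N}=\sum_i|x_i|^2$. Voronoi partition: for a finite set (grid) $\Gamma=\{x_1,\dots,x_n\}\subset\mathbb R^d$ (distinct points), a Voronoi partition $(C_i(\Gamma))_{1\le i\le n}$ is a Borel partition of $\mathbb R^d$ with $C_i(\Gamma)\subset\{\xi: |\xi-x_i|=\min_{j}|\xi-x_j|\}$. One such (arbitrary) partition is fixed for each grid $\Gamma$, and $\widehat X^\Gamma=\sum_i x_i\mathbf 1_{C_i(\Gamma)}(X)$ is the Voronoi quantization of $X$. Lloyd map: it sends $\Gamma=\{x_1,\dots,x_n\}$ to $\{x_1^*,\dots,x_n^*\}$, where $x_i^*=\mathbb E(X\mathbf 1_{\{X\in C_i(\Gamma)\}})/\mathbb P(X\in C_i(\Gamma))$ if $\mathbb P(X\in C_i(\Gamma))>0$ and $x_i^*=x_i$ otherwise. A grid $\Gamma$ is stationary (a fixed point of the Lloyd map) if $x_i^*=x_i$ for every $i$, i.e. each point is the $\mu$-centroid of its own cell whenever that cell has positive mass; equivalently $\widehat X^\Gamma=\mathbb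 E(X\,|\,\widehat X^\Gamma)$ a.s. Lloyd iterates and consistent representation: number $\Gamma^{(0)}=\{x^{(0)}_1,\dots,x^{(0)}_N\}$ and set recursively $\Gamma^{(k)}=\{x^{(k)}_1,\dots,x^{(k)}_N\}$ with $$x^{(k+1)}_i=\frac{\mathbb E\big(X\mathbf 1_{\{X\in C_i(\Gamma^{(k)})\}}\big)}{\mathbb P\big(X\in C_i(\Gamma^{(k)})\big)}\ \text{ if } \mathbb P\big(X\in C_i(\Gamma^{(k)})\big)>0,\qquad x_i^{(k+1)}=x_i^{(k)}\ \text{ otherwise},$$ where $C_i(\Gamma^{(k)})$ denotes the cell of the point $x_i^{(k)}$ (coinciding components, if any, share the same cell). The sequence of $N$-tuples $(x^{(k)})_{k\ge0}$ is called a consistent representation of $(\Gamma^{(k)})_{k\ge0}$. The sequence $(\Gamma^{(k)})$ is bounded if all $\Gamma^{(k)}$ lie in a common compact set. Convergence of grids: $\Gamma^{(\varphi(k))}\to\Gamma^{(\infty)}$ means that for a consistent representation, $x^{(\varphi(k))}$ converges in $(\mathbb R^d)^N$ to some $x^{(\infty)}$ and $\Gamma^{(\infty)}=\{x_1^{(\infty)},\dots,x_N^{(\infty)}\}$ (possibly with fewer than $N$ distinct points). A limiting grid is the limit of some subsequence. Distortion function: $\mathcal G(x)=\mathbb E\big(\min_{1\le i\le N}|X-x_i|^2\big)$ on $(\mathbb R^d)^N$. If $\mu$ charges no hyperplane, it is differentiable at every $x$ with pairwise distinct components, with $\frac{\partial\mathcal G}{\partial x_i}(x)=2\,\mathbb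 E\big(\mathbf 1_{\{X\in C_i(x)\}}(x_i-X)\big)$, where $C_i(x)=C_i(\{x_1,\dots,x_N\})$; in this case all the iterates $x^{(k)}$ have pairwise distinct components. *)

theory Defs
  imports "HOL-Probability.Probability"
begin

text \<open>
  The cells of a grid are indexed by its points: \<open>C a\<close> is the cell of \<open>a \<in> \<Gamma>\<close>.
\<close>

definition voronoi_partition :: "(real^'d) set \<Rightarrow> (real^'d \<Rightarrow> (real^'d) set) \<Rightarrow> bool" where
  "voronoi_partition \<Gamma> C \<longleftrightarrow>
     (\<forall>a\<in>\<Gamma>. C a \<in> sets borel) \<and>
     disjoint_family_on C \<Gamma> \<and>
     (\<Union>a\<in>\<Gamma>. C a) = UNIV \<and>
     (\<forall>a\<in>\<Gamma>. C a \<subseteq> {\<xi>. norm (\<xi> - a) = (MIN b\<in>\<Gamma>. norm (\<xi> - b))})"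

text \<open>
  A choice of one arbitrary partition for every (nonempty, finite) grid. Below, \<open>C \<Gamma> a\<close>
  is the cell of \<open>a\<close> in the partition chosen for \<open>\<Gamma>\<close>.
\<close>

definition voronoi_choice :: "((real^'d) set \<Rightarrow> real^'d \<Rightarrow> (real^'d) set) \<Rightarrow> bool" where
  "voronoi_choice C \<longleftrightarrow> (\<forall>\<Gamma>. finite \<Gamma> \<and> \<Gamma> \<noteq> {} \<longrightarrow> voronoi_partition \<Gamma> (C \<Gamma>))"

definition voronoi_quantization ::
  "((real^'d) set \<Rightarrow> real^'d \<Rightarrow> (real^'d) set) \<Rightarrow> ('a \<Rightarrow> real^'d) \<Rightarrow> (real^'d) set \<Rightarrow> 'a \<Rightarrow> real^'d" where
  "voronoi_quantization C X \<Gamma> \<omega> = (\<Sum>a\<in>\<Gamma>. indicat_real (C \<Gamma> a) (X \<omega>) *\<^sub>R a)"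

definition lloyd_point ::
  "((real^'d) set \<Rightarrow> real^'d \<Rightarrow> (real^'d) set) \<Rightarrow> 'a measure \<Rightarrow> ('a \<Rightarrow> real^'d) \<Rightarrow>
   (real^'d) set \<Rightarrow> real^'d \<Rightarrow> real^'d" where
  "lloyd_point C M X \<Gamma> a =
     (if \<P>(\<omega> in M. X \<omega> \<in> C \<Gamma> a) > 0
      then (\<integral>\<omega>. indicat_real (C \<Gamma> a) (X \<omega>) *\<^sub>R X \<omega> \<partial>M) /\<^sub>R \<P>(\<omega> in M. X \<omega> \<in> C \<Gamma> a)
      else a)"

definition lloyd_map ::
  "((real^'d) set \<Rightarrow> real^'d \<Rightarrow> (real^'d) set) \<Rightarrow> 'a measure \<Rightarrow> ('a \<Rightarrow> real^'d) \<Rightarrow>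
   (real^'d) set \<Rightarrow> (real^'d) set" where
  "lloyd_map C M X \<Gamma> = lloyd_point C M X \<Gamma> ` \<Gamma>"

definition stationary_grid ::
  "((real^'d) set \<Rightarrow> real^'d \<Rightarrow> (real^'d) set) \<Rightarrow> 'a measure \<Rightarrow> ('a \<Rightarrow> real^'d) \<Rightarrow>
   (real^'d) set \<Rightarrow> bool" where
  "stationary_grid C M X \<Gamma> \<longleftrightarrow> (\<forall>a\<in>\<Gamma>. lloyd_point C M X \<Gamma> a = a)"

text \<open>
  \<open>N\<close>-tuples are elements of \<open>real^'d^'n\<close> with \<open>N = CARD('n)\<close>; the library norm on this type is
  the Euclidean norm of \<open>(\<real>\<^sup>d)\<^sup>N\<close>. Components of a tuple may coincide, so its grid can have
  fewer than \<open>N\<close> points.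
\<close>

definition grid :: "real^'d^'n \<Rightarrow> (real^'d) set" where
  "grid x = range (\<lambda>i. x $ i)"

definition consistent_representation ::
  "((real^'d) set \<Rightarrow> real^'d \<Rightarrow> (real^'d) set) \<Rightarrow> 'a measure \<Rightarrow> ('a \<Rightarrow> real^'d) \<Rightarrow>
   (nat \<Rightarrow> (real^'d) set) \<Rightarrow> (nat \<Rightarrow> real^'d^'n) \<Rightarrow> bool" where
  "consistent_representation C M X \<Gamma> x \<longleftrightarrow>
     (\<forall>k. \<Gamma> k = grid (x k)) \<and>
     (\<forall>k i. x (Suc k) $ i = lloyd_point C M X (\<Gamma> k) (x k $ i))"

definition grid_limit :: "(nat \<Rightarrow> real^'d^'n) \<Rightarrow> (real^'d) set \<Rightarrow> bool" where
  "grid_limit y G \<longleftrightarrow> (\<exists>l. y \<longlonglongrightarrow> l \<and> G = grid l)"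

definition limiting_grid :: "(nat \<Rightarrow> real^'d^'n) \<Rightarrow> (real^'d) set \<Rightarrow> bool" where
  "limiting_grid x G \<longleftrightarrow> (\<exists>\<phi>. strict_mono (\<phi> :: nat \<Rightarrow> nat) \<and> grid_limit (x \<circ> \<phi>) G)"

definition subseq_limits :: "(nat \<Rightarrow> 'b::topological_space) \<Rightarrow> 'b set" where
  "subseq_limits x = {l. \<exists>\<phi>. strict_mono (\<phi> :: nat \<Rightarrow> nat) \<and> (x \<circ> \<phi>) \<longlonglongrightarrow> l}"

definition distortion :: "'a measure \<Rightarrow> ('a \<Rightarrow> real^'d) \<Rightarrow> real^'d^'n \<Rightarrow> real" where
  "distortion M X x = (\<integral>\<omega>. (MIN i. (norm (X \<omega> - x $ i))\<^sup>2) \<partial>M)"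

definition measure_support :: "'b::topological_space measure \<Rightarrow> 'b set" where
  "measure_support \<mu> = {x. \<forall>V. open V \<and> x \<in> V \<longrightarrow> emeasure \<mu> V > 0}"

definition charges_no_hyperplane :: "'b::euclidean_space measure \<Rightarrow> bool" where
  "charges_no_hyperplane \<mu> \<longleftrightarrow> (\<forall>a b. a \<noteq> 0 \<longrightarrow> emeasure \<mu> {\<xi>. a \<bullet> \<xi> = b} = 0)"

end

theory Submission
  imports Defs
begin

text \<open>
  Everything rests on the descent inequality: one Lloyd step lowers the distortion by at least
  \<open>\<Sum> p |\<Delta>|\<^sup>2\<close>, where \<open>p\<close> is the mass of a cell and \<open>\<Delta>\<close> the displacement of its point
  (\<open>distortion_decrease\<close>). Summing over all steps gives \<open>\<Sum> p |\<Delta>|\<^sup>2 < \<infinity>\<close> and therefore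
  \<open>p \<Delta> \<longlonglongrightarrow> 0\<close> for every component (\<open>weighted_steps_tendsto_0\<close>).

  Separation of the points: if a cluster of points collapses to \<open>z\<close>, then \<open>p \<Delta> \<longlonglongrightarrow> 0\<close> forces the mass of
  each cell of the cluster onto the limit of a bisecting hyperplane, because a cell lies on one side of
  this hyperplane while its centroid approaches it. These cells cover a neighbourhood of \<open>z\<close>, in which
  the support has interior points; finitely many hyperplanes cannot carry it
  (\<open>points_do_not_merge\<close>). This is the first part of the theorem. For the last part, separated points in a
  compact subset of the support have cells of mass bounded below, which turns \<open>\<Sum> p |\<Delta>|\<^sup>2 < \<infinity>\<close> into
  summability of the squared steps; a bounded sequence with vanishing steps has a compact connected
  set of limit points (\<open>connected_subseq_limits\<close>).

  Limiting grids: off the boundaries of the cells the nearest point is unique, which gives almost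
  sure convergence of the quantizations and, all points being bounded, convergence in \<open>L\<^sup>2\<close>.
  Passing to the limit in the expectations \<open>E (h(Y) (X - Y))\<close>, where \<open>Y\<close> is the quantization of
  \<open>X\<close> and \<open>h\<close> is a continuous function, turns \<open>p \<Delta> \<longlonglongrightarrow> 0\<close> into stationarity of the limit
  (\<open>limiting_grid_stationary\<close>).

  Gradients: if no hyperplane is charged, the points stay distinct and the distortion is
  differentiable, by dominated convergence of difference quotients (\<open>distortion_gderiv\<close>); the
  components of its gradient are \<open>- 2 p \<Delta>\<close>.
\<close>

section \<open>Voronoi cells\<close>

lemma voronoi_cell_nearest:
  assumes "voronoi_partition \<Gamma> C" "finite \<Gamma>" "a \<in> \<Gamma>" "b \<in> \<Gamma>" "\<xi> \<in> C a"
  shows "norm (\<xi> - a) \<le> norm (\<xi> - b)"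
proof -
  have "norm (\<xi> - a) = (MIN b\<in>\<Gamma>. norm (\<xi> - b))"
    using assms by (auto simp: voronoi_partition_def)
  also have "\<dots> \<le> norm (\<xi> - b)"
    using assms by (intro Min_le) auto
  finally show ?thesis .
qed

lemma voronoi_owner:
  assumes "voronoi_partition \<Gamma> C"
  obtains a where "a \<in> \<Gamma>" "\<xi> \<in> C a" "\<And>b. b \<in> \<Gamma> \<Longrightarrow> \<xi> \<in> C b \<Longrightarrow> b = a"
proof -
  have "\<xi> \<in> (\<Union>a\<in>\<Gamma>. C a)" "disjoint_family_on C \<Gamma>"
    using assms by (auto simp: voronoi_partition_def)
  then show thesis
    using that unfolding disjoint_family_on_def by blast
qed

lemma sum_indicator_cell:
  fixes f :: "real^'d \<Rightarrow> 'b::real_vector"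
  assumes "voronoi_partition \<Gamma> C" "finite \<Gamma>" "a \<in> \<Gamma>" "\<xi> \<in> C a"
  shows "(\<Sum>b\<in>\<Gamma>. indicat_real (C b) \<xi> *\<^sub>R f b) = f a"
proof -
  have "\<xi> \<notin> C b" if "b \<in> \<Gamma>" "b \<noteq> a" for b
    using assms that unfolding voronoi_partition_def disjoint_family_on_def by blast
  then have "(\<Sum>b\<in>\<Gamma>. indicat_real (C b) \<xi> *\<^sub>R f b) = (\<Sum>b\<in>\<Gamma>. if b = a then f a else 0)"
    using assms by (intro sum.cong) auto
  then show ?thesis
    using assms by simp
qed

lemma strictly_nearest_in_cell:
  assumes "voronoi_partition \<Gamma> C" "finite \<Gamma>" "a \<in> \<Gamma>"
    and "\<And>b. b \<in> \<Gamma> \<Longrightarrow> b \<noteq> a \<Longrightarrow> norm (\<xi> - a) < norm (\<xi> - b)"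
  shows "\<xi> \<in> C a"
proof -
  obtain b where b: "b \<in> \<Gamma>" "\<xi> \<in> C b"
    using voronoi_owner[OF assms(1)] by metis
  have "norm (\<xi> - b) \<le> norm (\<xi> - a)"
    using voronoi_cell_nearest[OF assms(1,2) b(1) assms(3) b(2)] .
  then show ?thesis
    using assms(4)[of b] b by fastforce
qed

text \<open>
  The difference of the squared distances to two points is an affine function of \<open>\<xi>\<close>. This is why
  centroids decide comparisons of distances: an affine function commutes with taking means.
\<close>
lemma norm_diff_sq_bisector:
  fixes a b \<xi> :: "'v::real_inner"
  shows "(norm (\<xi> - b))\<^sup>2 - (norm (\<xi> - a))\<^sup>2 = (2 *\<^sub>R (a - b)) \<bullet> \<xi> - (a \<bullet> a - b \<bullet> b)"
  by (simp add: power2_norm_eq_inner inner_diff_left inner_diff_right inner_commute)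

text \<open>
  A cell may own only part of its boundary, but at an interior point a tie with another point \<open>b\<close>
  is impossible: moving slightly towards \<open>b\<close> would make \<open>b\<close> strictly nearer without leaving the cell.
\<close>
lemma interior_cell_strictly_nearest:
  assumes part: "voronoi_partition \<Gamma> C" "finite \<Gamma>" "a \<in> \<Gamma>" "b \<in> \<Gamma>" "b \<noteq> a"
    and \<xi>: "\<xi> \<in> C a" "\<xi> \<notin> frontier (C a)"
  shows "norm (\<xi> - a) < norm (\<xi> - b)"
proof (rule ccontr)
  assume "\<not> norm (\<xi> - a) < norm (\<xi> - b)"
  then have "(norm (\<xi> - b))\<^sup>2 \<le> (norm (\<xi> - a))\<^sup>2"
    by (intro power_mono) auto
  then have at_\<xi>: "(2 *\<^sub>R (a - b)) \<bullet> \<xi> - (a \<bullet> a - b \<bullet> b) \<le> 0"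
    unfolding norm_diff_sq_bisector[symmetric] by simp
  have "\<xi> \<in> interior (C a)"
    using \<xi> closure_subset by (auto simp: frontier_def)
  then obtain e where e: "e > 0" "ball \<xi> e \<subseteq> C a"
    by (auto simp: mem_interior)
  define t where "t = e / (2 * norm (b - a))"
  have t: "t > 0" "t * norm (b - a) < e"
    using e(1) part(5) by (auto simp: t_def)
  let ?\<zeta> = "\<xi> + t *\<^sub>R (b - a)"
  have "?\<zeta> \<in> C a"
    using t e(2) by (intro subsetD[OF e(2)]) (simp add: dist_norm)
  then have "norm (?\<zeta> - a) \<le> norm (?\<zeta> - b)"
    by (rule voronoi_cell_nearest[OF part(1-4)])
  then have "(norm (?\<zeta> - a))\<^sup>2 \<le> (norm (?\<zeta> - b))\<^sup>2"
    by (intro power_mono) auto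
  then have "0 \<le> (2 *\<^sub>R (a - b)) \<bullet> ?\<zeta> - (a \<bullet> a - b \<bullet> b)"
    unfolding norm_diff_sq_bisector[symmetric] by simp
  also have "\<dots> = (2 *\<^sub>R (a - b)) \<bullet> \<xi> - (a \<bullet> a - b \<bullet> b) - 2 * t * ((b - a) \<bullet> (b - a))"
    by (simp add: inner_diff_left inner_diff_right inner_add_right algebra_simps inner_commute)
  also have "\<dots> < 0"
  proof -
    have "0 < 2 * t * ((b - a) \<bullet> (b - a))"
      using t(1) part(5) by simp
    then show ?thesis
      using at_\<xi> by linarith
  qed
  finally show False
    by simp
qed

lemma finite_grid [simp]: "finite (grid x)"
  and grid_nonempty [simp]: "grid x \<noteq> {}"
  and nth_in_grid [simp]: "x $ i \<in> grid x"
  by (auto simp: grid_def)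

lemma MIN_sq_eq:
  fixes x :: "real^'d^'n"
  assumes "voronoi_partition (grid x) C" "a \<in> grid x" "\<xi> \<in> C a"
  shows "(MIN i. (norm (\<xi> - x $ i))\<^sup>2) = (norm (\<xi> - a))\<^sup>2"
proof (rule Min_eqI)
  show "(norm (\<xi> - a))\<^sup>2 \<in> range (\<lambda>i. (norm (\<xi> - x $ i))\<^sup>2)"
    using assms(2) by (auto simp: grid_def)
  show "(norm (\<xi> - a))\<^sup>2 \<le> y" if "y \<in> range (\<lambda>i. (norm (\<xi> - x $ i))\<^sup>2)" for y
    using that voronoi_cell_nearest[OF assms(1) _ assms(2) _ assms(3)] by (auto intro!: power_mono)
qed auto

section \<open>Centroids of cells and the distortion\<close>

locale voronoi_quantizer = prob_space M for M :: "'a measure" +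
  fixes X :: "'a \<Rightarrow> real^'d"
    and C :: "(real^'d) set \<Rightarrow> real^'d \<Rightarrow> (real^'d) set"
  assumes X_measurable [measurable]: "X \<in> borel_measurable M"
    and X_square_integrable: "integrable M (\<lambda>\<omega>. (norm (X \<omega>))\<^sup>2)"
    and choice: "voronoi_choice C"
begin

abbreviation cell_prob :: "(real^'d) set \<Rightarrow> real^'d \<Rightarrow> real" where
  "cell_prob \<Gamma> a \<equiv> \<P>(\<omega> in M. X \<omega> \<in> C \<Gamma> a)"

abbreviation lloyd :: "(real^'d) set \<Rightarrow> real^'d \<Rightarrow> real^'d" where
  "lloyd \<equiv> lloyd_point C M X"

lemma partition: "finite \<Gamma> \<Longrightarrow> a \<in> \<Gamma> \<Longrightarrow> voronoi_partition \<Gamma> (C \<Gamma>)"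
  using choice by (auto simp: voronoi_choice_def)

lemma partition_grid: "voronoi_partition (grid x) (C (grid x))"
  using choice by (simp add: voronoi_choice_def)

lemma cell_borel: "finite \<Gamma> \<Longrightarrow> a \<in> \<Gamma> \<Longrightarrow> C \<Gamma> a \<in> sets borel"
  using partition by (auto simp: voronoi_partition_def)

lemma indicator_cell_measurable:
  "finite \<Gamma> \<Longrightarrow> a \<in> \<Gamma> \<Longrightarrow> (\<lambda>\<omega>. indicat_real (C \<Gamma> a) (X \<omega>)) \<in> borel_measurable M"
  using cell_borel[of \<Gamma> a] by measurable

lemma X_integrable: "integrable M X"
proof -
  have "integrable M (\<lambda>\<omega>. 1 + (norm (X \<omega>))\<^sup>2)"
    using X_square_integrable by auto
  then show ?thesis
  proof (rule Bochner_Integration.integrable_bound)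
    have "t \<le> 1 + t\<^sup>2" for t :: real
      using zero_le_power2[of "2 * t - 1"] by (simp add: power2_diff power_mult_distrib)
    then show "AE \<omega> in M. norm (X \<omega>) \<le> norm (1 + (norm (X \<omega>))\<^sup>2)"
      by (intro AE_I2) (auto simp: abs_of_nonneg add_nonneg_nonneg)
  qed simp
qed

lemma norm_sq_diff_integrable: "integrable M (\<lambda>\<omega>. (norm (X \<omega> - a))\<^sup>2)"
proof -
  have "integrable M (\<lambda>\<omega>. (norm (X \<omega>))\<^sup>2 - 2 * (X \<omega> \<bullet> a) + a \<bullet> a)"
    using X_square_integrable X_integrable by auto
  then show ?thesis
    by (simp add: power2_norm_eq_inner inner_diff_left inner_diff_right inner_commute algebra_simps)
qed

lemma expectation_indicator_cell:
  assumes "finite \<Gamma>" "a \<in> \<Gamma>"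
  shows "integrable M (\<lambda>\<omega>. indicat_real (C \<Gamma> a) (X \<omega>))"
    and "(\<integral>\<omega>. indicat_real (C \<Gamma> a) (X \<omega>) \<partial>M) = cell_prob \<Gamma> a"
proof -
  let ?A = "{\<omega>\<in>space M. X \<omega> \<in> C \<Gamma> a}"
  note [measurable] = cell_borel[OF assms]
  have A: "?A \<in> events"
    by measurable
  have "integrable M (indicat_real ?A)"
    using A by (auto simp: emeasure_eq_measure)
  then show "integrable M (\<lambda>\<omega>. indicat_real (C \<Gamma> a) (X \<omega>))"
    by (subst Bochner_Integration.integrable_cong[OF refl, of _ _ "indicat_real ?A"]) (auto simp: indicator_def)
  have "(\<integral>\<omega>. indicat_real (C \<Gamma> a) (X \<omega>) \<partial>M) = (\<integral>\<omega>. indicat_real ?A \<omega> \<partial>M)"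
    by (intro Bochner_Integration.integral_cong) (auto simp: indicator_def)
  also have "\<dots> = prob ?A"
    using A by simp
  finally show "(\<integral>\<omega>. indicat_real (C \<Gamma> a) (X \<omega>) \<partial>M) = cell_prob \<Gamma> a" .
qed

lemma indicator_cell_integrable:
  fixes f :: "'a \<Rightarrow> 'b::{banach, second_countable_topology}"
  assumes "finite \<Gamma>" "a \<in> \<Gamma>" "integrable M f"
  shows "integrable M (\<lambda>\<omega>. indicat_real (C \<Gamma> a) (X \<omega>) *\<^sub>R f \<omega>)"
  using assms(3)
proof (rule Bochner_Integration.integrable_bound)
  show "(\<lambda>\<omega>. indicat_real (C \<Gamma> a) (X \<omega>) *\<^sub>R f \<omega>) \<in> borel_measurable M"
    using indicator_cell_measurable[OF assms(1,2)] assms(3) by measurable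
qed (auto simp: indicator_def)

text \<open>
  If the cell has positive mass this is the definition of the Lloyd point; otherwise both sides
  vanish.
\<close>
lemma expectation_cell_eq_lloyd:
  assumes "finite \<Gamma>" "a \<in> \<Gamma>"
  shows "(\<integral>\<omega>. indicat_real (C \<Gamma> a) (X \<omega>) *\<^sub>R X \<omega> \<partial>M) = cell_prob \<Gamma> a *\<^sub>R lloyd \<Gamma> a"
proof (cases "cell_prob \<Gamma> a > 0")
  case False
  then have "cell_prob \<Gamma> a = 0"
    using measure_nonneg[of M] by (metis less_eq_real_def)
  moreover have "AE \<omega> in M. indicat_real (C \<Gamma> a) (X \<omega>) *\<^sub>R X \<omega> = 0"
  proof -
    have "{\<omega>\<in>space M. X \<omega> \<in> C \<Gamma> a} \<in> events"
      using cell_borel[OF assms] by measurable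
    then have "AE \<omega> in M. X \<omega> \<notin> C \<Gamma> a"
      using \<open>cell_prob \<Gamma> a = 0\<close> by (subst AE_iff_measurable[OF _ refl]) (auto simp: emeasure_eq_measure)
    then show ?thesis
      by auto
  qed
  ultimately show ?thesis
    by (simp add: integral_eq_zero_AE)
qed (simp add: lloyd_point_def)

lemma expectation_cell_affine:
  assumes "finite \<Gamma>" "a \<in> \<Gamma>"
  shows "integrable M (\<lambda>\<omega>. indicat_real (C \<Gamma> a) (X \<omega>) * (v \<bullet> X \<omega> - c))"
    and "(\<integral>\<omega>. indicat_real (C \<Gamma> a) (X \<omega>) * (v \<bullet> X \<omega> - c) \<partial>M)
      = cell_prob \<Gamma> a * (v \<bullet> lloyd \<Gamma> a - c)"
proof -
  let ?I = "\<lambda>\<omega>. indicat_real (C \<Gamma> a) (X \<omega>)"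
  have eq: "(\<lambda>\<omega>. ?I \<omega> * (v \<bullet> X \<omega> - c)) = (\<lambda>\<omega>. (?I \<omega> *\<^sub>R X \<omega>) \<bullet> v - ?I \<omega> * c)"
    by (auto simp: algebra_simps inner_commute)
  have int: "integrable M (\<lambda>\<omega>. ?I \<omega> *\<^sub>R X \<omega>)"
    using assms X_integrable by (rule indicator_cell_integrable)
  note int1 = expectation_indicator_cell[OF assms]
  show "integrable M (\<lambda>\<omega>. ?I \<omega> * (v \<bullet> X \<omega> - c))"
    unfolding eq using int int1(1)
    by (intro Bochner_Integration.integrable_diff integrable_inner_left integrable_mult_left)
  have "(\<integral>\<omega>. ?I \<omega> * (v \<bullet> X \<omega> - c) \<partial>M)
      = (\<integral>\<omega>. (?I \<omega> *\<^sub>R X \<omega>) \<bullet> v \<partial>M) - (\<integral>\<omega>. ?I \<omega> * c \<partial>M)"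
    unfolding eq using int int1(1)
    by (intro Bochner_Integration.integral_diff integrable_inner_left integrable_mult_left)
  also have "\<dots> = (cell_prob \<Gamma> a *\<^sub>R lloyd \<Gamma> a) \<bullet> v - cell_prob \<Gamma> a * c"
    using int by (simp only: integral_inner_left integral_mult_left_zero int1
        expectation_cell_eq_lloyd[OF assms])
  finally show "(\<integral>\<omega>. ?I \<omega> * (v \<bullet> X \<omega> - c) \<partial>M) = cell_prob \<Gamma> a * (v \<bullet> lloyd \<Gamma> a - c)"
    by (simp add: algebra_simps inner_commute)
qed

lemma sq_distance_integrable:
  fixes x :: "real^'d^'n"
  shows "integrable M (\<lambda>\<omega>. MIN i. (norm (X \<omega> - x $ i))\<^sup>2)"
proof -
  have "(MIN i. (norm (\<xi> - x $ i))\<^sup>2)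
      = (\<Sum>a\<in>grid x. indicat_real (C (grid x) a) \<xi> *\<^sub>R (norm (\<xi> - a))\<^sup>2)" for \<xi>
  proof -
    obtain a where a: "a \<in> grid x" "\<xi> \<in> C (grid x) a"
      using voronoi_owner[OF partition_grid] by metis
    show ?thesis
      unfolding MIN_sq_eq[OF partition_grid a]
      by (rule sum_indicator_cell[OF partition_grid finite_grid a, symmetric])
  qed
  then show ?thesis
    by (simp only:) (intro Bochner_Integration.integrable_sum indicator_cell_integrable
        norm_sq_diff_integrable finite_grid)
qed

text \<open>
  Moving a point to the centroid of its cell lowers the second moment of that cell by the mass times
  the squared displacement (Huygens), and the old cells are still an admissible, possibly no longer
  optimal, assignment for the new grid. The decrease is indexed by the points of the grid rather than
  by the components of the tuple, since coinciding components share one cell.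
\<close>
lemma distortion_decrease:
  fixes x y :: "real^'d^'n"
  assumes y: "\<And>i. y $ i = lloyd (grid x) (x $ i)"
  shows "(\<Sum>a\<in>grid x. cell_prob (grid x) a * (norm (lloyd (grid x) a - a))\<^sup>2)
    \<le> distortion M X x - distortion M X y"
proof -
  let ?G = "grid x" and ?L = "lloyd (grid x)"
  let ?aff = "\<lambda>a \<xi>. (2 *\<^sub>R (?L a - a)) \<bullet> \<xi> - (?L a \<bullet> ?L a - a \<bullet> a)"
  have point: "(\<Sum>a\<in>?G. indicat_real (C ?G a) \<xi> * ?aff a \<xi>)
      \<le> (MIN i. (norm (\<xi> - x $ i))\<^sup>2) - (MIN i. (norm (\<xi> - y $ i))\<^sup>2)" for \<xi>
  proof -
    obtain a where a: "a \<in> ?G" "\<xi> \<in> C ?G a"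
      using voronoi_owner[OF partition_grid] by metis
    then obtain i where i: "a = x $ i"
      by (auto simp: grid_def)
    have "(MIN i. (norm (\<xi> - y $ i))\<^sup>2) \<le> (norm (\<xi> - y $ i))\<^sup>2"
      by (intro Min_le) auto
    then have "(norm (\<xi> - a))\<^sup>2 - (norm (\<xi> - ?L a))\<^sup>2
        \<le> (MIN i. (norm (\<xi> - x $ i))\<^sup>2) - (MIN i. (norm (\<xi> - y $ i))\<^sup>2)"
      using MIN_sq_eq[OF partition_grid a] y i by simp
    moreover have "(\<Sum>a\<in>?G. indicat_real (C ?G a) \<xi> * ?aff a \<xi>) = ?aff a \<xi>"
      using sum_indicator_cell[OF partition_grid finite_grid a, of "\<lambda>a. ?aff a \<xi>"] by simp
    ultimately show ?thesis
      by (simp only: norm_diff_sq_bisector)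
  qed
  have "(\<Sum>a\<in>?G. cell_prob ?G a * (norm (?L a - a))\<^sup>2) = (\<Sum>a\<in>?G. cell_prob ?G a * ?aff a (?L a))"
    by (intro sum.cong refl arg_cong2[where f = "(*)"])
       (simp add: power2_norm_eq_inner inner_diff_left inner_diff_right inner_commute)
  also have "\<dots> = (\<Sum>a\<in>?G. \<integral>\<omega>. indicat_real (C ?G a) (X \<omega>) * ?aff a (X \<omega>) \<partial>M)"
    by (intro sum.cong refl expectation_cell_affine(2)[symmetric]) auto
  also have "\<dots> = (\<integral>\<omega>. (\<Sum>a\<in>?G. indicat_real (C ?G a) (X \<omega>) * ?aff a (X \<omega>)) \<partial>M)"
    by (intro Bochner_Integration.integral_sum[symmetric] expectation_cell_affine(1)) auto
  also have "\<dots> \<le> (\<integral>\<omega>. (MIN i. (norm (X \<omega> - x $ i))\<^sup>2) - (MIN i. (norm (X \<omega> - y $ i))\<^sup>2) \<partial>M)"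
    by (intro integral_mono point Bochner_Integration.integrable_sum
          Bochner_Integration.integrable_diff sq_distance_integrable expectation_cell_affine(1)) auto
  also have "\<dots> = distortion M X x - distortion M X y"
    unfolding distortion_def
    by (intro Bochner_Integration.integral_diff sq_distance_integrable)
  finally show ?thesis .
qed

text \<open>
  The affine function \<open>|\<xi> - b|\<^sup>2 - |\<xi> - a|\<^sup>2\<close> is nonnegative on the cell of \<open>a\<close>. If it does not
  vanish almost surely there, it is positive at the centroid. A cell whose mass is carried by a bisecting
  hyperplane could share its centroid with the neighbouring cell; the hypothesis excludes this.
\<close>
lemma lloyd_strictly_nearer:
  assumes \<Gamma>: "finite \<Gamma>" "a \<in> \<Gamma>" "b \<in> \<Gamma>" "a \<noteq> b"
    and pos: "cell_prob \<Gamma> a > 0 \<Longrightarrow>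
      \<P>(\<omega> in M. X \<omega> \<in> C \<Gamma> a \<and> norm (X \<omega> - a) < norm (X \<omega> - b)) > 0"
  shows "norm (lloyd \<Gamma> a - a) < norm (lloyd \<Gamma> a - b)"
proof (cases "cell_prob \<Gamma> a > 0")
  case False
  then show ?thesis
    using \<Gamma> by (simp add: lloyd_point_def)
next
  case True
  let ?f = "\<lambda>\<xi>. (2 *\<^sub>R (a - b)) \<bullet> \<xi> - (a \<bullet> a - b \<bullet> b)"
  let ?g = "\<lambda>\<omega>. indicat_real (C \<Gamma> a) (X \<omega>) * ?f (X \<omega>)"
  have f: "?f \<xi> = (norm (\<xi> - b))\<^sup>2 - (norm (\<xi> - a))\<^sup>2" for \<xi>
    by (rule norm_diff_sq_bisector[symmetric])
  have nonneg: "0 \<le> ?g \<omega>" for \<omega>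
    unfolding f using voronoi_cell_nearest[OF partition[OF \<Gamma>(1,2)] \<Gamma>(1-3), of "X \<omega>"]
    by (auto simp: indicator_def intro!: power_mono)
  have "integral\<^sup>L M ?g \<noteq> 0"
  proof
    assume "integral\<^sup>L M ?g = 0"
    then have "AE \<omega> in M. ?g \<omega> = 0"
      using integral_nonneg_eq_0_iff_AE[OF expectation_cell_affine(1)[OF \<Gamma>(1,2)]] nonneg by blast
    then have "AE \<omega> in M. \<not> (X \<omega> \<in> C \<Gamma> a \<and> norm (X \<omega> - a) < norm (X \<omega> - b))"
    proof (eventually_elim, safe)
      fix \<omega> assume *: "?g \<omega> = 0" "X \<omega> \<in> C \<Gamma> a" "norm (X \<omega> - a) < norm (X \<omega> - b)"
      then have "(norm (X \<omega> - a))\<^sup>2 < (norm (X \<omega> - b))\<^sup>2"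
        by (intro power_strict_mono) auto
      with * show False
        unfolding f by auto
    qed
    then have "\<P>(\<omega> in M. X \<omega> \<in> C \<Gamma> a \<and> norm (X \<omega> - a) < norm (X \<omega> - b)) = 0"
      by (rule prob_eq_0_AE)
    with pos[OF True] show False
      by simp
  qed
  moreover have "integral\<^sup>L M ?g \<ge> 0"
    using nonneg by (intro integral_nonneg_AE) auto
  ultimately have "0 < cell_prob \<Gamma> a * ?f (lloyd \<Gamma> a)"
    unfolding expectation_cell_affine(2)[OF \<Gamma>(1,2)] by linarith
  then have "0 < ?f (lloyd \<Gamma> a)"
    using True by (rule zero_less_mult_pos)
  then have "(norm (lloyd \<Gamma> a - a))\<^sup>2 < (norm (lloyd \<Gamma> a - b))\<^sup>2"
    unfolding f by simp
  then show ?thesis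
    by (rule power2_less_imp_less) simp
qed

end

lemma norm_vec_le_card:
  fixes v :: "'b::real_normed_vector^'n"
  assumes "\<And>i. norm (v $ i) \<le> B"
  shows "norm v \<le> real CARD('n) * B"
proof -
  have "norm v \<le> (\<Sum>i\<in>UNIV. norm (v $ i))"
    unfolding norm_vec_def by (intro L2_set_le_sum) auto
  also have "\<dots> \<le> real CARD('n) * B"
    using sum_bounded_above[of UNIV "\<lambda>i. norm (v $ i)" B] assms by simp
  finally show ?thesis .
qed

section \<open>The support of the distribution\<close>

context voronoi_quantizer
begin

lemma prob_pos_at_support:
  assumes "y \<in> measure_support (distr M borel X)" "open V" "y \<in> V"
  shows "\<P>(\<omega> in M. X \<omega> \<in> V) > 0"
proof -
  have "emeasure (distr M borel X) V > 0"
    using assms by (auto simp: measure_support_def)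
  also have "emeasure (distr M borel X) V = emeasure M (X -` V \<inter> space M)"
    using assms by (intro emeasure_distr) auto
  also have "X -` V \<inter> space M = {\<omega>\<in>space M. X \<omega> \<in> V}"
    by auto
  finally show ?thesis
    by (simp add: emeasure_eq_measure)
qed

text \<open>
  The complement of the support is a union of open null sets; a countable subfamily has the same
  union.
\<close>
lemma AE_in_support: "AE \<omega> in M. X \<omega> \<in> measure_support (distr M borel X)"
proof -
  let ?\<mu> = "distr M borel X"
  let ?F = "{V. open V \<and> emeasure ?\<mu> V = 0}"
  obtain F where F: "F \<subseteq> ?F" "countable F" "\<Union>F = \<Union>?F"
    using Lindelof[of ?F] by auto
  have "(\<Union>V\<in>F. V) \<in> null_sets ?\<mu>"
    using F(1) by (intro null_sets_UN' F(2)) (auto simp: null_sets_def)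
  then have "AE \<xi> in ?\<mu>. \<xi> \<notin> \<Union>?F"
    unfolding F(3)[symmetric] by (intro AE_not_in) simp
  then have "AE \<xi> in ?\<mu>. \<xi> \<in> measure_support ?\<mu>"
    by eventually_elim (auto simp: measure_support_def zero_less_iff_neq_zero)
  then show ?thesis
    by (rule AE_distrD[rotated]) simp
qed

text \<open>
  A hyperplane that strictly separates the centroid from \<open>U\<close> would also separate it from almost every
  value of \<open>X\<close>.
\<close>
lemma lloyd_in_closed_convex:
  assumes U: "closed U" "convex U" "AE \<omega> in M. X \<omega> \<in> U"
    and \<Gamma>: "finite \<Gamma>" "a \<in> \<Gamma>" "a \<in> U"
  shows "lloyd \<Gamma> a \<in> U"
proof (rule ccontr)
  assume notin: "lloyd \<Gamma> a \<notin> U"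
  then have pos: "cell_prob \<Gamma> a > 0"
    using \<Gamma>(3) by (auto simp: lloyd_point_def split: if_splits)
  obtain v c where v: "v \<bullet> lloyd \<Gamma> a < c" "\<And>\<xi>. \<xi> \<in> U \<Longrightarrow> c < v \<bullet> \<xi>"
    using separating_hyperplane_closed_point[OF U(2,1) notin] by blast
  have "0 \<le> (\<integral>\<omega>. indicat_real (C \<Gamma> a) (X \<omega>) * (v \<bullet> X \<omega> - c) \<partial>M)"
    using U(3) by (intro integral_nonneg_AE, eventually_elim)
      (auto simp: indicator_def less_imp_le[OF v(2)])
  also have "\<dots> = cell_prob \<Gamma> a * (v \<bullet> lloyd \<Gamma> a - c)"
    by (rule expectation_cell_affine(2)[OF \<Gamma>(1,2)])
  also have "\<dots> < 0"
    using pos v(1) by (intro mult_pos_neg) auto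
  finally show False
    by simp
qed

end

section \<open>Lloyd iterates\<close>

locale lloyd_sequence = voronoi_quantizer M X C
  for M :: "'a measure" and X :: "'a \<Rightarrow> real^'d" and C +
  fixes x :: "nat \<Rightarrow> real^'d^'n"
  assumes step: "x (Suc k) $ i = lloyd_point C M X (grid (x k)) (x k $ i)"
    and bounded_sequence: "bounded (range x)"
begin

abbreviation mass :: "nat \<Rightarrow> 'n \<Rightarrow> real" where
  "mass k i \<equiv> cell_prob (grid (x k)) (x k $ i)"

text \<open>
  The distortion decreases to a nonnegative limit, so the decreases are summable.
\<close>
lemma summable_weighted_steps:
  "summable (\<lambda>k. mass k i * (norm (x (Suc k) $ i - x k $ i))\<^sup>2)"
proof (rule summableI_nonneg_bounded)
  let ?D = "\<lambda>k. distortion M X (x k)"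
  have le: "mass k i * (norm (x (Suc k) $ i - x k $ i))\<^sup>2 \<le> ?D k - ?D (Suc k)" for k
  proof -
    let ?f = "\<lambda>a. cell_prob (grid (x k)) a * (norm (lloyd (grid (x k)) a - a))\<^sup>2"
    have "?f (x k $ i) \<le> sum ?f (grid (x k))"
      by (rule member_le_sum) auto
    also have "\<dots> \<le> ?D k - ?D (Suc k)"
      by (rule distortion_decrease) (rule step)
    finally show ?thesis
      by (simp add: step)
  qed
  fix n
  have "(\<Sum>k<n. mass k i * (norm (x (Suc k) $ i - x k $ i))\<^sup>2) \<le> (\<Sum>k<n. ?D k - ?D (Suc k))"
    by (intro sum_mono le)
  also have "\<dots> = ?D 0 - ?D n"
    by (induction n) auto
  also have "\<dots> \<le> ?D 0"
  proof -
    have "?D n \<ge> 0"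
      unfolding distortion_def by (intro integral_nonneg_AE AE_I2) (auto intro!: Min.boundedI)
    then show ?thesis
      by simp
  qed
  finally show "(\<Sum>k<n. mass k i * (norm (x (Suc k) $ i - x k $ i))\<^sup>2) \<le> ?D 0" .
qed simp

text \<open>
  The weights cannot be dropped in general, since the cell of a point may become negligible; the
  weighted steps are what passes to limits of the grids.
\<close>
lemma weighted_steps_tendsto_0:
  "(\<lambda>k. mass k i *\<^sub>R (x (Suc k) $ i - x k $ i)) \<longlonglongrightarrow> 0"
proof -
  have lim: "(\<lambda>k. mass k i * (norm (x (Suc k) $ i - x k $ i))\<^sup>2) \<longlonglongrightarrow> 0"
    by (rule summable_LIMSEQ_zero[OF summable_weighted_steps])
  have "(\<lambda>k. (norm (mass k i *\<^sub>R (x (Suc k) $ i - x k $ i)))\<^sup>2) \<longlonglongrightarrow> 0"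
  proof (rule tendsto_sandwich[OF _ _ tendsto_const lim])
    have "m\<^sup>2 * t \<le> m * t" if "0 \<le> m" "m \<le> 1" "0 \<le> t" for m t :: real
      using that by (intro mult_right_mono) (auto simp: power2_eq_square mult_left_le)
    then show "\<forall>\<^sub>F k in sequentially. (norm (mass k i *\<^sub>R (x (Suc k) $ i - x k $ i)))\<^sup>2
        \<le> mass k i * (norm (x (Suc k) $ i - x k $ i))\<^sup>2"
      by (auto simp: power_mult_distrib)
  qed simp
  then have "(\<lambda>k. norm (mass k i *\<^sub>R (x (Suc k) $ i - x k $ i))) \<longlonglongrightarrow> 0"
    by simp
  then show ?thesis
    by (rule tendsto_norm_zero_cancel)
qed

text \<open>
  A common image of two distinct points would be strictly nearer to each of them than to the other.
  The positivity hypothesis is met both if no hyperplane is charged and if the points lie in the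
  support.
\<close>
lemma distinct_preserved:
  assumes init: "inj (\<lambda>i. x 0 $ i)"
    and pos: "\<And>k i j. x k $ i \<noteq> x k $ j \<Longrightarrow> mass k i > 0 \<Longrightarrow>
      \<P>(\<omega> in M. X \<omega> \<in> C (grid (x k)) (x k $ i) \<and>
        norm (X \<omega> - x k $ i) < norm (X \<omega> - x k $ j)) > 0"
  shows "inj (\<lambda>i. x k $ i)"
proof (induction k)
  case (Suc k)
  have near: "norm (x (Suc k) $ i - x k $ i) < norm (x (Suc k) $ i - x k $ j)" if "i \<noteq> j" for i j
    unfolding step[of k i] using that Suc pos
    by (intro lloyd_strictly_nearer) (auto simp: inj_eq[OF Suc])
  show ?case
  proof (rule injI, rule ccontr)
    fix i j assume "x (Suc k) $ i = x (Suc k) $ j" "i \<noteq> j"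
    then show False
      using near[of i j] near[of j i] by auto
  qed
qed (rule init)

end

section \<open>Points of the iterates stay apart under full support\<close>

locale lloyd_in_full_support = lloyd_sequence M X C x
  for M :: "'a measure" and X :: "'a \<Rightarrow> real^'d" and C and x :: "nat \<Rightarrow> real^'d^'n" +
  fixes U :: "(real^'d) set"
  assumes closed_U: "closed U" and convex_U: "convex U" and interior_U: "interior U \<noteq> {}"
    and support: "measure_support (distr M borel X) = U"
    and initial_in_U: "x 0 $ i \<in> U"
    and initial_distinct: "inj (\<lambda>i. x 0 $ i)"
begin

lemma iterate_in_U: "x k $ i \<in> U"
proof (induction k)
  case (Suc k)
  then show ?case
    unfolding step using AE_in_support support
    by (intro lloyd_in_closed_convex closed_U convex_U) auto
qed (rule initial_in_U)

lemma iterates_distinct: "inj (\<lambda>i. x k $ i)"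
proof (rule distinct_preserved[OF initial_distinct])
  fix k i j assume neq: "x k $ i \<noteq> x k $ j"
  let ?V = "{\<xi>. \<forall>b\<in>grid (x k) - {x k $ i}. norm (\<xi> - x k $ i) < norm (\<xi> - b)}"
  have "?V = (\<Inter>b\<in>grid (x k) - {x k $ i}. {\<xi>. norm (\<xi> - x k $ i) < norm (\<xi> - b)})"
    by auto
  then have "open ?V"
    by (auto intro!: open_INT open_Collect_less continuous_intros)
  then have "0 < \<P>(\<omega> in M. X \<omega> \<in> ?V)"
    using iterate_in_U support by (intro prob_pos_at_support[of "x k $ i"]) auto
  also have "\<dots> \<le> \<P>(\<omega> in M. X \<omega> \<in> C (grid (x k)) (x k $ i) \<and>
      norm (X \<omega> - x k $ i) < norm (X \<omega> - x k $ j))"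
  proof (rule finite_measure_mono)
    show "{\<omega>\<in>space M. X \<omega> \<in> C (grid (x k)) (x k $ i) \<and>
        norm (X \<omega> - x k $ i) < norm (X \<omega> - x k $ j)} \<in> events"
      using cell_borel[of "grid (x k)" "x k $ i"] by measurable
    show "{\<omega>\<in>space M. X \<omega> \<in> ?V} \<subseteq> {\<omega>\<in>space M. X \<omega> \<in> C (grid (x k)) (x k $ i) \<and>
        norm (X \<omega> - x k $ i) < norm (X \<omega> - x k $ j)}"
      using neq by (auto intro!: strictly_nearest_in_cell[OF partition_grid])
  qed
  finally show "\<P>(\<omega> in M. X \<omega> \<in> C (grid (x k)) (x k $ i) \<and>
      norm (X \<omega> - x k $ i) < norm (X \<omega> - x k $ j)) > 0" .
qed

text \<open>
  Suppose several points converge to the same \<open>z\<close>, and let \<open>I\<close> be the set of their indices. For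
  \<open>i \<in> I\<close> choose a companion \<open>J i\<close> in the same cluster, with direction \<open>u\<close> from the point to the
  companion and midpoint \<open>m\<close>. On the cell of \<open>i\<close> the function \<open>u \<bullet> (m - \<xi>)\<close> is nonnegative, and its
  integral over the cell is controlled by the weighted step and by the distance from the point to
  \<open>m\<close>, so it tends to \<open>0\<close>: asymptotically the mass of the cell concentrates on the hyperplane
  through \<open>z\<close> orthogonal to the limiting direction. But the cells of the cluster together cover a
  fixed ball around \<open>z\<close>, and in this ball the support contains an open set, which finitely many
  hyperplanes cannot exhaust.
\<close>
lemma points_do_not_merge:
  assumes r: "strict_mono r" and l: "(\<lambda>n. x (r n)) \<longlonglongrightarrow> l"
    and W: "(\<lambda>n. \<chi> i j. sgn (x (r n) $ j - x (r n) $ i)) \<longlonglongrightarrow> W"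
  shows "inj (\<lambda>i. l $ i)"
proof (rule ccontr)
  assume "\<not> inj (\<lambda>i. l $ i)"
  then obtain i0 j0 where ij0: "i0 \<noteq> j0" "l $ i0 = l $ j0"
    by (auto simp: inj_def)
  define z where "z = l $ i0"
  define I where "I = {i. l $ i = z}"
  define J where "J i = (if i = i0 then j0 else i0)" for i
  have J: "J i \<noteq> i" "J i \<in> I" for i
    using ij0 by (auto simp: J_def I_def z_def)
  define u where "u n i = sgn (x (r n) $ J i - x (r n) $ i)" for n i
  define m where "m n i = (x (r n) $ i + x (r n) $ J i) /\<^sub>R 2" for n i
  define w where "w i = W $ i $ J i" for i
  have lim_x: "(\<lambda>n. x (r n) $ i) \<longlonglongrightarrow> l $ i" for i
    using l by (rule tendsto_vec_nth)
  have lim_u: "(\<lambda>n. u n i) \<longlonglongrightarrow> w i" for i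
    using tendsto_vec_nth[OF tendsto_vec_nth[OF W, of i], of "J i"] by (simp add: u_def w_def)
  have lim_m: "(\<lambda>n. m n i) \<longlonglongrightarrow> z" if "i \<in> I" for i
  proof -
    have "(\<lambda>n. m n i) \<longlonglongrightarrow> (l $ i + l $ J i) /\<^sub>R 2"
      unfolding m_def by (intro tendsto_intros lim_x)
    also have "(l $ i + l $ J i) /\<^sub>R 2 = z"
      using that J(2)[of i] by (simp add: I_def flip: scaleR_2)
    finally show ?thesis .
  qed
  have norm_u: "norm (u n i) = 1" for n i
    using J(1)[of i] injD[OF iterates_distinct[of "r n"], of "J i" i]
    by (auto simp: u_def norm_sgn)
  have norm_w: "norm (w i) = 1" for i
    using tendsto_norm[OF lim_u[of i]] by (simp add: norm_u LIMSEQ_const_iff)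
  have z_in: "z \<in> U"
    unfolding z_def by (rule closed_sequentially[OF closed_U iterate_in_U lim_x])
  \<comment> \<open>The factor \<open>4\<close> leaves room for moving \<open>\<xi>\<close>, the cluster and the other points by \<open>\<rho>\<close> each.\<close>
  obtain \<rho> where \<rho>: "\<rho> > 0" "\<And>i. i \<notin> I \<Longrightarrow> 4 * \<rho> \<le> dist z (l $ i)"
  proof -
    obtain d where "d > 0" "\<forall>y\<in>range (\<lambda>i. l $ i). y \<noteq> z \<longrightarrow> d \<le> dist z y"
      using finite_set_avoid[of "range (\<lambda>i. l $ i)" z] by auto
    then show thesis
      by (intro that[of "d / 4"]) (auto simp: I_def)
  qed
  \<comment> \<open>A point of the interior of \<open>U\<close> near \<open>z\<close> that avoids the limits of the bisecting hyperplanes.\<close>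
  let ?H = "\<Union>i\<in>I. {\<xi>. w i \<bullet> \<xi> = w i \<bullet> z}"
  have "interior U \<inter> ball z \<rho> \<noteq> {}"
  proof -
    have "z \<in> closure (interior U)"
      using convex_closure_interior[OF convex_U interior_U] z_in closure_subset by blast
    then obtain y where "y \<in> interior U" "dist y z < \<rho>"
      using \<rho>(1) by (auto simp: closure_approachable)
    then show ?thesis
      by (auto simp: dist_commute)
  qed
  moreover have "negligible ?H"
  proof (intro negligible_Union finite_imageI)
    have "w i \<noteq> 0" for i
      using norm_w[of i] by auto
    then show "negligible T" if "T \<in> (\<lambda>i. {\<xi>. w i \<bullet> \<xi> = w i \<bullet> z}) ` I" for T
      using that by (auto intro!: negligible_hyperplane)
  qed simp
  ultimately have "\<not> interior U \<inter> ball z \<rho> \<subseteq> ?H"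
    using open_not_negligible[of "interior U \<inter> ball z \<rho>"] negligible_subset by (meson open_Int open_ball open_interior)
  then obtain y where y: "y \<in> interior U" "y \<in> ball z \<rho>" "y \<notin> ?H"
    by blast
  obtain \<eta> where \<eta>: "\<eta> > 0" "\<And>i. i \<in> I \<Longrightarrow> 2 * \<eta> < \<bar>w i \<bullet> (z - y)\<bar>"
  proof -
    let ?S = "(\<lambda>i. \<bar>w i \<bullet> (z - y)\<bar>) ` I"
    have S: "finite ?S" "?S \<noteq> {}" "\<And>t. t \<in> ?S \<Longrightarrow> t > 0"
      using y(3) J(2) by (auto simp: inner_diff_right)
    have pos: "Min ?S > 0"
      using S by simp
    have "2 * (Min ?S / 3) < \<bar>w i \<bullet> (z - y)\<bar>" if "i \<in> I" for i
    proof -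
      have "Min ?S \<le> \<bar>w i \<bullet> (z - y)\<bar>"
        by (rule Min_le[OF S(1)]) (rule imageI[OF that])
      then show ?thesis
        using pos by linarith
    qed
    then show thesis
      using pos by (intro that[of "Min ?S / 3"]) auto
  qed
  define B where "B = ball y \<eta> \<inter> ball z \<rho>"
  have "\<P>(\<omega> in M. X \<omega> \<in> B) > 0"
    using y \<eta>(1) support interior_subset unfolding B_def
    by (intro prob_pos_at_support[of y]) auto
  let ?G = "\<lambda>n. grid (x (r n))"
  let ?g = "\<lambda>n i \<xi>. indicat_real (C (?G n) (x (r n) $ i)) \<xi> * (- u n i \<bullet> \<xi> - (- u n i \<bullet> m n i))"
  have g_nonneg: "0 \<le> ?g n i \<xi>" for n i \<xi>
  proof (cases "\<xi> \<in> C (?G n) (x (r n) $ i)")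
    case True
    let ?a = "x (r n) $ i" and ?b = "x (r n) $ J i"
    have "(norm (\<xi> - ?a))\<^sup>2 \<le> (norm (\<xi> - ?b))\<^sup>2"
      using voronoi_cell_nearest[OF partition_grid _ _ _ True, of ?b] by (auto intro!: power_mono)
    moreover have "(norm (\<xi> - ?b))\<^sup>2 - (norm (\<xi> - ?a))\<^sup>2 = 2 * ((?b - ?a) \<bullet> (m n i - \<xi>))"
      by (simp add: norm_diff_sq_bisector m_def inner_diff_left inner_diff_right inner_add_right
          inner_commute field_simps)
    ultimately have "0 \<le> (?b - ?a) \<bullet> (m n i - \<xi>)"
      by linarith
    then have "0 \<le> u n i \<bullet> (m n i - \<xi>)"
      by (simp add: u_def sgn_div_norm)
    then show ?thesis
      using True by (simp add: inner_diff_right)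
  qed simp
  have "\<forall>\<^sub>F n in sequentially. \<P>(\<omega> in M. X \<omega> \<in> B)
      \<le> (\<Sum>i\<in>I. (norm (m n i - x (r n) $ i)
          + norm (mass (r n) i *\<^sub>R (x (Suc (r n)) $ i - x (r n) $ i))) / \<eta>)"
  proof -
    have "\<forall>\<^sub>F n in sequentially. \<forall>i\<in>UNIV. dist (x (r n) $ i) (l $ i) < \<rho>"
      by (intro eventually_ball_finite ballI tendstoD lim_x \<rho>(1)) simp
    moreover have "\<forall>\<^sub>F n in sequentially. \<forall>i\<in>I. 2 * \<eta> < \<bar>u n i \<bullet> (m n i - y)\<bar>"
    proof (intro eventually_ball_finite ballI)
      fix i assume i: "i \<in> I"
      have "(\<lambda>n. \<bar>u n i \<bullet> (m n i - y)\<bar>) \<longlonglongrightarrow> \<bar>w i \<bullet> (z - y)\<bar>"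
        by (intro tendsto_intros lim_u lim_m i)
      then show "\<forall>\<^sub>F n in sequentially. 2 * \<eta> < \<bar>u n i \<bullet> (m n i - y)\<bar>"
        using \<eta>(2)[OF i] by (rule order_tendstoD)
    qed simp
    ultimately show ?thesis
    proof eventually_elim
      case (elim n)
      have point: "indicat_real B \<xi> \<le> (\<Sum>i\<in>I. ?g n i \<xi> / \<eta>)" for \<xi>
      proof (cases "\<xi> \<in> B")
        case True
        obtain a where a: "a \<in> ?G n" "\<xi> \<in> C (?G n) a"
          using voronoi_owner[OF partition_grid] by metis
        then obtain i where i: "a = x (r n) $ i"
          by (auto simp: grid_def)
        have "i \<in> I"
        proof (rule ccontr)
          assume "i \<notin> I"
          then have "4 * \<rho> \<le> dist z (l $ i)"
            by (rule \<rho>(2))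
          moreover have "dist (x (r n) $ i) (l $ i) < \<rho>" "dist (x (r n) $ i0) z < \<rho>"
            using elim(1) by (auto simp: z_def)
          moreover have "dist \<xi> z < \<rho>"
            using True by (simp add: B_def dist_commute)
          moreover have "dist \<xi> (x (r n) $ i) \<le> dist \<xi> (x (r n) $ i0)"
            using voronoi_cell_nearest[OF partition_grid _ a(1) _ a(2), of "x (r n) $ i0"] i
            by (simp add: dist_norm)
          ultimately show False
            using dist_triangle[of z "l $ i" \<xi>] dist_triangle[of \<xi> "l $ i" "x (r n) $ i"]
              dist_triangle[of \<xi> "x (r n) $ i0" z] by (simp add: dist_commute)
        qed
        have "\<bar>u n i \<bullet> (y - \<xi>)\<bar> \<le> norm (u n i) * norm (y - \<xi>)"
          by (rule Cauchy_Schwarz_ineq2)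
        also have "\<dots> < \<eta>"
          using True by (simp add: norm_u B_def dist_norm)
        finally have "\<bar>u n i \<bullet> (y - \<xi>)\<bar> < \<eta>" .
        moreover have "2 * \<eta> < \<bar>u n i \<bullet> (m n i - y)\<bar>"
          using elim(2) \<open>i \<in> I\<close> by blast
        ultimately have "\<eta> < \<bar>u n i \<bullet> (m n i - \<xi>)\<bar>"
          by (simp add: inner_diff_right)
        moreover have "?g n i \<xi> = u n i \<bullet> (m n i - \<xi>)"
          using a i by (simp add: inner_diff_right)
        ultimately have "\<eta> < ?g n i \<xi>"
          using g_nonneg[of n i \<xi>] by linarith
        then have "1 \<le> ?g n i \<xi> / \<eta>"
          using \<eta>(1) by (simp only: le_divide_eq_1_pos less_imp_le)
        also have "\<dots> \<le> (\<Sum>i\<in>I. ?g n i \<xi> / \<eta>)"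
          using \<open>i \<in> I\<close> \<eta>(1) by (intro member_le_sum divide_nonneg_pos g_nonneg) auto
        finally show ?thesis
          using True by simp
      next
        case False
        then have "indicat_real B \<xi> = 0"
          by simp
        also have "0 \<le> (\<Sum>i\<in>I. ?g n i \<xi> / \<eta>)"
          by (intro sum_nonneg divide_nonneg_pos g_nonneg \<eta>(1))
        finally show ?thesis .
      qed
      have "{\<omega>\<in>space M. X \<omega> \<in> B} \<in> events"
        by (simp add: B_def)
      then have "\<P>(\<omega> in M. X \<omega> \<in> B) = (\<integral>\<omega>. indicat_real {\<omega>\<in>space M. X \<omega> \<in> B} \<omega> \<partial>M)"
        by simp
      also have "\<dots> \<le> (\<integral>\<omega>. (\<Sum>i\<in>I. ?g n i (X \<omega>) / \<eta>) \<partial>M)"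
      proof (rule integral_mono)
        show "integrable M (indicat_real {\<omega>\<in>space M. X \<omega> \<in> B})"
          using \<open>{\<omega>\<in>space M. X \<omega> \<in> B} \<in> events\<close> by (auto simp: emeasure_eq_measure)
        show "integrable M (\<lambda>\<omega>. \<Sum>i\<in>I. ?g n i (X \<omega>) / \<eta>)"
          by (intro Bochner_Integration.integrable_sum integrable_divide expectation_cell_affine(1)) auto
        show "indicat_real {\<omega>\<in>space M. X \<omega> \<in> B} \<omega> \<le> (\<Sum>i\<in>I. ?g n i (X \<omega>) / \<eta>)" if "\<omega> \<in> space M" for \<omega>
          using point[of "X \<omega>"] that by (simp only: indicator_def mem_Collect_eq simp_thms)
      qed
      also have "\<dots> = (\<Sum>i\<in>I. (\<integral>\<omega>. ?g n i (X \<omega>) \<partial>M) / \<eta>)"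
        by (subst Bochner_Integration.integral_sum)
          (intro integrable_divide expectation_cell_affine(1) finite_grid nth_in_grid,
           simp only: integral_divide_zero)
      also have "\<dots> \<le> (\<Sum>i\<in>I. (norm (m n i - x (r n) $ i)
          + norm (mass (r n) i *\<^sub>R (x (Suc (r n)) $ i - x (r n) $ i))) / \<eta>)"
      proof (intro sum_mono divide_right_mono)
        fix i
        let ?p = "mass (r n) i" and ?L = "x (Suc (r n)) $ i" and ?a = "x (r n) $ i"
        have "(\<integral>\<omega>. ?g n i (X \<omega>) \<partial>M) = ?p * (- u n i \<bullet> ?L - (- u n i \<bullet> m n i))"
          unfolding step by (intro expectation_cell_affine(2)) auto
        also have "\<dots> = ?p * (u n i \<bullet> (m n i - ?a)) - u n i \<bullet> (?p *\<^sub>R (?L - ?a))"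
          by (simp add: inner_diff_right algebra_simps)
        also have "\<dots> \<le> \<bar>?p * (u n i \<bullet> (m n i - ?a))\<bar> + \<bar>u n i \<bullet> (?p *\<^sub>R (?L - ?a))\<bar>"
          by linarith
        also have "\<dots> \<le> norm (m n i - ?a) + norm (?p *\<^sub>R (?L - ?a))"
        proof (intro add_mono)
          have "\<bar>?p * (u n i \<bullet> (m n i - ?a))\<bar> = ?p * \<bar>u n i \<bullet> (m n i - ?a)\<bar>"
            by (simp add: abs_mult)
          also have "\<dots> \<le> 1 * (norm (u n i) * norm (m n i - ?a))"
            by (intro mult_mono Cauchy_Schwarz_ineq2) auto
          finally show "\<bar>?p * (u n i \<bullet> (m n i - ?a))\<bar> \<le> norm (m n i - ?a)"
            by (simp add: norm_u)
          show "\<bar>u n i \<bullet> (?p *\<^sub>R (?L - ?a))\<bar> \<le> norm (?p *\<^sub>R (?L - ?a))"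
            using Cauchy_Schwarz_ineq2[of "u n i" "?p *\<^sub>R (?L - ?a)"] by (simp only: norm_u mult_1)
        qed
        finally show "(\<integral>\<omega>. ?g n i (X \<omega>) \<partial>M) \<le> norm (m n i - ?a) + norm (?p *\<^sub>R (?L - ?a))" .
      qed (use \<eta>(1) in simp)
      finally show ?case .
    qed
  qed
  moreover have "(\<lambda>n. \<Sum>i\<in>I. (norm (m n i - x (r n) $ i)
          + norm (mass (r n) i *\<^sub>R (x (Suc (r n)) $ i - x (r n) $ i))) / \<eta>)
      \<longlonglongrightarrow> (\<Sum>i\<in>I. (norm (z - l $ i) + norm (0 :: real^'d)) / \<eta>)"
  proof (intro tendsto_sum tendsto_divide tendsto_add tendsto_norm tendsto_diff lim_m lim_x tendsto_const)
    show "(\<lambda>n. mass (r n) i *\<^sub>R (x (Suc (r n)) $ i - x (r n) $ i)) \<longlonglongrightarrow> 0" for i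
      using LIMSEQ_subseq_LIMSEQ[OF weighted_steps_tendsto_0 r] by (simp add: o_def)
  qed (use \<eta>(1) in auto)
  ultimately have "\<P>(\<omega> in M. X \<omega> \<in> B) \<le> (\<Sum>i\<in>I. (norm (z - l $ i) + norm (0 :: real^'d)) / \<eta>)"
    by (intro tendsto_lowerbound[of _ _ sequentially]) auto
  also have "\<dots> = 0"
    by (intro sum.neutral) (auto simp: I_def)
  finally show False
    using \<open>\<P>(\<omega> in M. X \<omega> \<in> B) > 0\<close> by simp
qed

end

section \<open>Limit points of slowly varying bounded sequences\<close>

text \<open>In this form the set of limit points is visibly closed.\<close>
lemma subseq_limits_eq_INT_closure:
  fixes f :: "nat \<Rightarrow> 'b::metric_space"
  shows "subseq_limits f = (\<Inter>n. closure (f ` {n..}))"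
proof safe
  fix l n assume "l \<in> subseq_limits f"
  then obtain r where r: "strict_mono r" "(f \<circ> r) \<longlonglongrightarrow> l"
    by (auto simp: subseq_limits_def)
  have "(\<lambda>k. f (r (k + n))) \<longlonglongrightarrow> l"
    using LIMSEQ_ignore_initial_segment[OF r(2), of n] by (simp add: o_def)
  moreover have "f (r (k + n)) \<in> f ` {n..}" for k
    using seq_suble[OF r(1), of "k + n"] by auto
  ultimately show "l \<in> closure (f ` {n..})"
    unfolding closure_sequential by (intro exI[of _ "\<lambda>k. f (r (k + n))"]) blast
next
  fix l assume l: "l \<in> (\<Inter>n. closure (f ` {n..}))"
  have *: "\<exists>k\<ge>n. dist (f k) l < e" if "e > 0" for n e
  proof -
    have "l \<in> closure (f ` {n..})"
      using l by blast
    then show ?thesis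
      using that unfolding closure_approachable by auto
  qed
  have "\<exists>r. \<forall>n. dist (f (r n)) l < inverse (real (Suc n)) \<and> r n < r (Suc n)"
  proof (rule dependent_nat_choice)
    show "\<exists>k. dist (f k) l < inverse (real (Suc 0))"
      using *[of "inverse (real (Suc 0))" 0] by auto
    show "\<exists>k'. dist (f k') l < inverse (real (Suc (Suc n))) \<and> k < k'" for k n
      using *[of "inverse (real (Suc (Suc n)))" "Suc k"] by auto
  qed
  then obtain r where r: "\<And>n. dist (f (r n)) l < inverse (real (Suc n))" "strict_mono r"
    by (auto simp: strict_mono_Suc_iff)
  have "(\<lambda>n. dist (f (r n)) l) \<longlonglongrightarrow> 0"
    by (rule tendsto_sandwich[OF _ _ tendsto_const LIMSEQ_inverse_real_of_nat])
      (use less_imp_le[OF r(1)] in \<open>auto intro!: always_eventually simp del: of_nat_Suc\<close>)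
  then have "(f \<circ> r) \<longlonglongrightarrow> l"
    by (subst tendsto_dist_iff) (simp add: o_def)
  with r(2) show "l \<in> subseq_limits f"
    unfolding subseq_limits_def by blast
qed

lemma subseq_limit_of_frequently:
  fixes f :: "nat \<Rightarrow> 'b::heine_borel"
  assumes "bounded (range f)" "\<exists>\<^sub>F k in sequentially. P k"
  obtains r l where "strict_mono r" "\<And>n. P (r n)" "(\<lambda>n. f (r n)) \<longlonglongrightarrow> l" "l \<in> subseq_limits f"
proof -
  have inf: "infinite {k. P k}"
    using assms(2) by (simp add: frequently_cofinite flip: cofinite_eq_sequentially)
  define e where "e = enumerate {k. P k}"
  have e: "strict_mono e" "\<And>n. P (e n)"
    using inf enumerate_in_set[OF inf] by (auto simp: e_def intro: strict_mono_enumerate)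
  have "bounded (range (f \<circ> e))"
    using assms(1) by (rule bounded_subset) auto
  then obtain l r where r: "strict_mono r" "((f \<circ> e) \<circ> r) \<longlonglongrightarrow> l"
    using bounded_imp_convergent_subsequence[of "f \<circ> e"] by blast
  have "strict_mono (e \<circ> r)"
    using e(1) r(1) by (rule strict_mono_o)
  then show thesis
    using r(2) e(2) by (intro that[of "e \<circ> r" l]) (auto simp: o_def subseq_limits_def)
qed

lemma compact_subseq_limits:
  fixes f :: "nat \<Rightarrow> 'b::heine_borel"
  assumes "bounded (range f)"
  shows "compact (subseq_limits f)"
proof -
  have "subseq_limits f \<subseteq> closure (range f)"
    unfolding subseq_limits_eq_INT_closure by (metis INT_lower UNIV_I atLeast_0)
  then have "bounded (subseq_limits f)"
    using assms bounded_closure bounded_subset by blast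
  moreover have "closed (subseq_limits f)"
    unfolding subseq_limits_eq_INT_closure by auto
  ultimately show ?thesis
    by (simp add: compact_eq_bounded_closed)
qed

text \<open>
  If the limit points split into two compact pieces at distance \<open>d\<close>, the sequence visits the
  neighbourhoods of both infinitely often. With steps tending to \<open>0\<close> it must then be infinitely often
  in the shell of points whose distance to the first piece is between \<open>d/3\<close> and \<open>2d/3\<close>, and it has a
  limit point there, which lies in neither piece.
\<close>
lemma connected_subseq_limits:
  fixes f :: "nat \<Rightarrow> 'b::{heine_borel, real_normed_vector}"
  assumes bdd: "bounded (range f)" and small: "(\<lambda>k. f (Suc k) - f k) \<longlonglongrightarrow> 0"
  shows "connected (subseq_limits f)"
  unfolding connected_closed
proof clarify
  let ?S = "subseq_limits f"
  fix A B assume AB: "closed A" "closed B" "?S \<subseteq> A \<union> B" "A \<inter> B \<inter> ?S = {}"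
    "A \<inter> ?S \<noteq> {}" "B \<inter> ?S \<noteq> {}"
  let ?P = "A \<inter> ?S" and ?Q = "B \<inter> ?S"
  have comp: "compact ?P" "compact ?Q"
    using compact_subseq_limits[OF bdd] AB(1,2) by (auto intro: closed_Int_compact)
  obtain d where d: "d > 0" "\<And>p q. p \<in> ?P \<Longrightarrow> q \<in> ?Q \<Longrightarrow> d \<le> dist p q"
    using separate_compact_closed[of ?P ?Q] comp AB(4) compact_imp_closed by blast
  define g where "g y = infdist y ?P" for y
  have g_lim: "(\<lambda>n. g (f (r n))) \<longlonglongrightarrow> g l" if "(\<lambda>n. f (r n)) \<longlonglongrightarrow> l" for r l
    unfolding g_def using that by (rule tendsto_infdist)
  have freq: "\<exists>\<^sub>F k in sequentially. R (g (f k))"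
    if l: "l \<in> ?S" and R: "\<And>r. (\<lambda>n. g (f (r n))) \<longlonglongrightarrow> g l \<Longrightarrow> \<forall>\<^sub>F n in sequentially. R (g (f (r n)))"
    for R l
  proof -
    obtain r where r: "strict_mono r" "(\<lambda>n. f (r n)) \<longlonglongrightarrow> l"
      using l by (auto simp: subseq_limits_def o_def)
    have "\<exists>\<^sub>F n in sequentially. R (g (f (r n)))"
      using R[OF g_lim[OF r(2)]] by (intro eventually_frequently) auto
    then show ?thesis
      using r(1) by (auto simp: frequently_def dest: eventually_subseq)
  qed
  obtain p q where pq: "p \<in> ?P" "q \<in> ?Q"
    using AB(5,6) by blast
  have gQ: "d \<le> g y" if "y \<in> ?Q" for y
    unfolding g_def infdist_notempty[OF AB(5)] using AB(5) d(2)[of _ y] that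
    by (intro cINF_greatest) (auto simp: dist_commute)
  have gP: "g y = 0" if "y \<in> ?P" for y
    using that by (simp add: g_def)
  have low: "\<exists>\<^sub>F k in sequentially. g (f k) < d / 3"
    using pq(1) gP[of p] d(1) by (intro freq[of p]) (auto dest: order_tendstoD(2)[of _ _ _ "d / 3"])
  have high: "\<exists>\<^sub>F k in sequentially. g (f k) > d / 3"
    using pq(2) gQ[of q] d(1) by (intro freq[of q]) (auto dest: order_tendstoD(1)[of _ _ _ "d / 3"])
  \<comment> \<open>Steps shorter than \<open>d/3\<close> cannot jump over the shell between the two pieces.\<close>
  have "\<exists>\<^sub>F k in sequentially. d / 3 \<le> g (f k) \<and> g (f k) \<le> 2 * d / 3"
    unfolding frequently_sequentially
  proof
    fix N
    have "\<forall>\<^sub>F k in sequentially. norm (f (Suc k) - f k) < d / 3"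
      using tendstoD[OF small, of "d / 3"] d(1) by simp
    then obtain N' where N': "\<And>k. k \<ge> N' \<Longrightarrow> norm (f (Suc k) - f k) < d / 3"
      by (auto simp: eventually_sequentially)
    obtain k where k: "k \<ge> max N N'" "g (f k) < d / 3"
      using low unfolding frequently_sequentially by blast
    obtain k' where k': "k' \<ge> k" "g (f k') > d / 3"
      using high unfolding frequently_sequentially by blast
    have "\<exists>m. k \<le> m \<and> g (f m) < d / 3 \<and> d / 3 \<le> g (f (Suc m))"
    proof (rule ccontr)
      assume *: "\<not> ?thesis"
      have "g (f k') < d / 3"
        using k'(1) by (induction k' rule: dec_induct) (use k(2) * in \<open>auto simp: not_le\<close>)
      with k'(2) show False
        by simp
    qed
    then obtain m where m: "k \<le> m" "g (f m) < d / 3" "d / 3 \<le> g (f (Suc m))"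
      by blast
    have "g (f (Suc m)) \<le> dist (f (Suc m)) (f m) + g (f m)"
      unfolding g_def by (metis add.commute infdist_triangle)
    also have "\<dots> \<le> d / 3 + d / 3"
      using N'[of m] k(1) m by (intro add_mono) (auto simp: dist_norm)
    finally show "\<exists>n\<ge>N. d / 3 \<le> g (f n) \<and> g (f n) \<le> 2 * d / 3"
      using m k(1) by (intro exI[of _ "Suc m"]) auto
  qed
  then obtain r l where "strict_mono r"
      and r: "\<And>n. d / 3 \<le> g (f (r n)) \<and> g (f (r n)) \<le> 2 * d / 3"
        "(\<lambda>n. f (r n)) \<longlonglongrightarrow> l" "l \<in> ?S"
    by (rule subseq_limit_of_frequently[OF bdd]) blast
  have "d / 3 \<le> g l"
    by (rule LIMSEQ_le_const[OF g_lim[OF r(2)]]) (use r(1) in blast)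
  moreover have "g l \<le> 2 * d / 3"
    by (rule LIMSEQ_le_const2[OF g_lim[OF r(2)]]) (use r(1) in blast)
  ultimately show False
    using AB(3) r(3) gP[of l] gQ[of l] d(1) by auto
qed

section \<open>Square summable steps under full support\<close>

context voronoi_quantizer
begin

lemma ball_prob_bounded_below:
  assumes K: "compact K" "K \<subseteq> measure_support (distr M borel X)" and "\<delta> > 0"
  obtains c where "c > 0" "\<And>y. y \<in> K \<Longrightarrow> c \<le> \<P>(\<omega> in M. X \<omega> \<in> ball y \<delta>)"
proof -
  obtain D where D: "finite D" "D \<subseteq> K" "K \<subseteq> (\<Union>z\<in>D. ball z (\<delta> / 2))"
    using \<open>\<delta> > 0\<close> by (rule_tac compactE_image[OF K(1), of K "\<lambda>z. ball z (\<delta> / 2)"]) auto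
  let ?p = "\<lambda>z. \<P>(\<omega> in M. X \<omega> \<in> ball z (\<delta> / 2))"
  define c where "c = Min (insert 1 (?p ` D))"
  have "0 < ?p z" if "z \<in> D" for z
    using that D(2) K(2) \<open>\<delta> > 0\<close> by (intro prob_pos_at_support[of z]) auto
  then have "c > 0"
    using D(1) by (auto simp: c_def)
  moreover have "c \<le> \<P>(\<omega> in M. X \<omega> \<in> ball y \<delta>)" if "y \<in> K" for y
  proof -
    obtain z where z: "z \<in> D" "dist z y < \<delta> / 2"
      using D(3) \<open>y \<in> K\<close> by auto
    have "c \<le> ?p z"
      using z(1) D(1) unfolding c_def by (intro Min_le) auto
    also have "\<dots> \<le> \<P>(\<omega> in M. X \<omega> \<in> ball y \<delta>)"
    proof (rule finite_measure_mono)
      have "dist y w < \<delta>" if "dist z w < \<delta> / 2" for w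
        using dist_triangle[of y w z] z(2) that by (simp add: dist_commute)
      then show "{\<omega>\<in>space M. X \<omega> \<in> ball z (\<delta> / 2)} \<subseteq> {\<omega>\<in>space M. X \<omega> \<in> ball y \<delta>}"
        by auto
    qed simp
    finally show ?thesis .
  qed
  ultimately show thesis
    using that by blast
qed

end

context lloyd_in_full_support
begin

text \<open>
  By compactness of the tuples and of the unit directions between their components, a failure
  would produce exactly the convergent configuration excluded by \<open>points_do_not_merge\<close>.
\<close>
lemma points_stay_apart:
  "\<exists>\<delta>>0. \<forall>\<^sub>F k in sequentially. \<forall>i j. i \<noteq> j \<longrightarrow> \<delta> \<le> norm (x k $ i - x k $ j)"
proof (rule ccontr)
  assume not_apart: "\<not> ?thesis"
  have "\<exists>\<^sub>F k in sequentially. \<exists>i j. i \<noteq> j \<and> norm (x k $ i - x k $ j) < \<delta>" if "\<delta> > 0" for \<delta>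
  proof -
    have "\<not> (\<forall>\<^sub>F k in sequentially. \<forall>i j. i \<noteq> j \<longrightarrow> \<delta> \<le> norm (x k $ i - x k $ j))"
      using not_apart that by blast
    then show ?thesis
      unfolding not_eventually by (rule frequently_elim1) (auto simp: not_le)
  qed
  then have *: "\<exists>k\<ge>n. \<exists>i j. i \<noteq> j \<and> norm (x k $ i - x k $ j) < \<delta>" if "\<delta> > 0" for n \<delta>
    using that by (auto simp: frequently_sequentially)
  let ?close = "\<lambda>n k. \<exists>i j. i \<noteq> j \<and> norm (x k $ i - x k $ j) < inverse (real (Suc n))"
  have "\<exists>r. \<forall>n. ?close n (r n) \<and> r n < r (Suc n)"
  proof (rule dependent_nat_choice)
    show "\<exists>k. ?close 0 k"
      using *[of "inverse (real (Suc 0))" 0] by auto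
    show "\<exists>k'. ?close (Suc n) k' \<and> k < k'" for k n
    proof -
      have "\<exists>k'\<ge>Suc k. ?close (Suc n) k'"
        by (rule *) simp
      then show ?thesis
        by (meson Suc_le_lessD)
    qed
  qed
  then obtain r where r: "\<And>n. ?close n (r n)" "strict_mono r"
    by (auto simp: strict_mono_Suc_iff)
  let ?dir = "\<lambda>n. (\<chi> i j. sgn (x (r n) $ j - x (r n) $ i)) :: real^'d^'n^'n"
  let ?w = "\<lambda>n. (x (r n), ?dir n)"
  have "bounded (range ?w)"
  proof (rule bounded_subset[OF bounded_Times])
    show "bounded (range x)"
      by (rule bounded_sequence)
    show "bounded (range ?dir)"
    proof -
      have "norm (?dir n) \<le> real CARD('n) * (real CARD('n) * 1)" for n
        by (intro norm_vec_le_card) (simp add: norm_sgn)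
      then show ?thesis
        by (auto simp: bounded_iff)
    qed
  qed auto
  then obtain lw s where s: "strict_mono s" "(?w \<circ> s) \<longlonglongrightarrow> lw"
    using bounded_imp_convergent_subsequence[of ?w] by blast
  let ?l = "fst lw"
  have lim: "(\<lambda>n. x ((r \<circ> s) n)) \<longlonglongrightarrow> ?l"
    using tendsto_fst[OF s(2)] by (simp add: o_def)
  have "(\<lambda>n. \<chi> i j. sgn (x ((r \<circ> s) n) $ j - x ((r \<circ> s) n) $ i)) \<longlonglongrightarrow> snd lw"
    using tendsto_snd[OF s(2)] by (simp add: o_def)
  then have inj: "inj (\<lambda>i. ?l $ i)"
    using strict_mono_o[OF r(2) s(1)] lim points_do_not_merge by blast
  have "\<forall>\<^sub>F n in sequentially. \<forall>ij\<in>{ij. fst ij \<noteq> snd ij}.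
      0 < norm (x (r (s n)) $ fst ij - x (r (s n)) $ snd ij) - inverse (real (Suc (s n)))"
  proof (intro eventually_ball_finite ballI)
    fix ij :: "'n \<times> 'n" assume "ij \<in> {ij. fst ij \<noteq> snd ij}"
    then have "0 < norm (?l $ fst ij - ?l $ snd ij) - 0"
      using injD[OF inj, of "fst ij" "snd ij"] by auto
    moreover have "(\<lambda>n. inverse (real (Suc (s n)))) \<longlonglongrightarrow> 0"
      using LIMSEQ_subseq_LIMSEQ[OF LIMSEQ_inverse_real_of_nat s(1)] by (simp add: o_def)
    then have "(\<lambda>n. norm (x (r (s n)) $ fst ij - x (r (s n)) $ snd ij) - inverse (real (Suc (s n))))
        \<longlonglongrightarrow> norm (?l $ fst ij - ?l $ snd ij) - 0"
      using lim by (intro tendsto_intros) (auto simp: o_def)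
    ultimately show "\<forall>\<^sub>F n in sequentially.
        0 < norm (x (r (s n)) $ fst ij - x (r (s n)) $ snd ij) - inverse (real (Suc (s n)))"
      by (rule order_tendstoD(1)[rotated])
  qed simp
  then obtain n where "\<And>i j. i \<noteq> j \<Longrightarrow>
      inverse (real (Suc (s n))) < norm (x (r (s n)) $ i - x (r (s n)) $ j)"
    by (auto simp: eventually_sequentially)
  then show False
    using r(1)[of "s n"] by (metis less_asym)
qed

text \<open>
  Separated points own a ball of fixed radius around them, and such balls have mass bounded away from
  \<open>0\<close> on the compact closure of the set of all points of the iterates. Hence the weights can be removed from
  \<open>summable_weighted_steps\<close>.
\<close>
lemma mass_bounded_below:
  obtains c where "c > 0" "\<forall>\<^sub>F k in sequentially. \<forall>i. c \<le> mass k i"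
proof -
  obtain \<delta> where \<delta>: "\<delta> > 0"
    "\<forall>\<^sub>F k in sequentially. \<forall>i j. i \<noteq> j \<longrightarrow> \<delta> \<le> norm (x k $ i - x k $ j)"
    using points_stay_apart by blast
  let ?K = "closure (range (\<lambda>(k, i). x k $ i))"
  obtain B where B: "\<And>k. norm (x k) \<le> B"
    using bounded_sequence by (auto simp: bounded_iff)
  have "norm (x k $ i) \<le> B" for k i
    using Finite_Cartesian_Product.norm_nth_le[of "x k" i] B[of k] by linarith
  then have "compact ?K"
    by (subst compact_closure) (auto simp: bounded_iff)
  moreover have "?K \<subseteq> U"
    using iterate_in_U by (intro closure_minimal closed_U) auto
  ultimately obtain c where c: "c > 0" "\<And>y. y \<in> ?K \<Longrightarrow> c \<le> \<P>(\<omega> in M. X \<omega> \<in> ball y (\<delta> / 2))"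
    unfolding support[symmetric] by (rule ball_prob_bounded_below[OF _ _ half_gt_zero[OF \<delta>(1)]]) blast
  have "\<forall>\<^sub>F k in sequentially. \<forall>i. c \<le> mass k i"
    using \<delta>(2)
  proof (eventually_elim, intro allI)
    fix k i assume sep: "\<forall>i j. i \<noteq> j \<longrightarrow> \<delta> \<le> norm (x k $ i - x k $ j)"
    have "x k $ i \<in> range (\<lambda>(k, i). x k $ i)"
      by (rule range_eqI[of _ _ "(k, i)"]) simp
    then have "c \<le> \<P>(\<omega> in M. X \<omega> \<in> ball (x k $ i) (\<delta> / 2))"
      by (intro c(2) subsetD[OF closure_subset])
    also have "\<dots> \<le> mass k i"
    proof (rule finite_measure_mono)
      show "{\<omega>\<in>space M. X \<omega> \<in> C (grid (x k)) (x k $ i)} \<in> events"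
        using cell_borel[of "grid (x k)" "x k $ i"] by measurable
      have "\<xi> \<in> C (grid (x k)) (x k $ i)" if \<xi>: "\<xi> \<in> ball (x k $ i) (\<delta> / 2)" for \<xi>
      proof (rule strictly_nearest_in_cell[OF partition_grid finite_grid nth_in_grid])
        fix b assume "b \<in> grid (x k)" "b \<noteq> x k $ i"
        then obtain j where j: "b = x k $ j" "i \<noteq> j"
          by (auto simp: grid_def)
        have "\<delta> \<le> dist (x k $ i) b"
          using sep j by (simp add: dist_norm)
        then have "dist \<xi> (x k $ i) < dist \<xi> b"
          using \<xi> dist_triangle[of "x k $ i" b \<xi>] by (simp add: dist_commute)
        then show "norm (\<xi> - x k $ i) < norm (\<xi> - b)"
          by (simp add: dist_norm)
      qed
      then show "{\<omega>\<in>space M. X \<omega> \<in> ball (x k $ i) (\<delta> / 2)}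
          \<subseteq> {\<omega>\<in>space M. X \<omega> \<in> C (grid (x k)) (x k $ i)}"
        by blast
    qed
    finally show "c \<le> mass k i" .
  qed
  with c(1) that show thesis
    by blast
qed

lemma summable_steps: "summable (\<lambda>k. (norm (x (Suc k) - x k))\<^sup>2)"
proof -
  obtain c where c: "c > 0" "\<forall>\<^sub>F k in sequentially. \<forall>i. c \<le> mass k i"
    by (rule mass_bounded_below)
  have "summable (\<lambda>k. (norm (x (Suc k) $ i - x k $ i))\<^sup>2)" for i
  proof (rule summable_comparison_test_ev)
    show "summable (\<lambda>k. (mass k i * (norm (x (Suc k) $ i - x k $ i))\<^sup>2) / c)"
      by (intro summable_divide summable_weighted_steps)
    show "\<forall>\<^sub>F k in sequentially. norm ((norm (x (Suc k) $ i - x k $ i))\<^sup>2)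
        \<le> (mass k i * (norm (x (Suc k) $ i - x k $ i))\<^sup>2) / c"
      using c(2)
    proof eventually_elim
      case (elim k)
      then have "c * (norm (x (Suc k) $ i - x k $ i))\<^sup>2 \<le> mass k i * (norm (x (Suc k) $ i - x k $ i))\<^sup>2"
        by (intro mult_right_mono) auto
      then show ?case
        using c(1) by (simp add: pos_le_divide_eq mult.commute)
    qed
  qed
  moreover have "(norm v)\<^sup>2 = (\<Sum>i\<in>UNIV. (norm (v $ i))\<^sup>2)" for v :: "real^'d^'n"
    by (simp add: norm_vec_def L2_set_def sum_nonneg)
  ultimately show ?thesis
    by (simp add: summable_sum)
qed

lemma steps_tendsto_0: "(\<lambda>k. x (Suc k) - x k) \<longlonglongrightarrow> 0"
proof -
  have "(\<lambda>k. (norm (x (Suc k) - x k))\<^sup>2) \<longlonglongrightarrow> 0"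
    by (rule summable_LIMSEQ_zero[OF summable_steps])
  then have "(\<lambda>k. norm (x (Suc k) - x k)) \<longlonglongrightarrow> 0"
    by simp
  then show ?thesis
    by (rule tendsto_norm_zero_cancel)
qed

lemma subseq_limits_in_U: "subseq_limits x \<subseteq> {y. \<forall>i. y $ i \<in> U}"
proof safe
  fix l i assume "l \<in> subseq_limits x"
  then obtain r where "(\<lambda>n. x (r n)) \<longlonglongrightarrow> l"
    by (auto simp: subseq_limits_def o_def)
  then have "(\<lambda>n. x (r n) $ i) \<longlonglongrightarrow> l $ i"
    by (rule tendsto_vec_nth)
  then show "l $ i \<in> U"
    by (rule closed_sequentially[OF closed_U iterate_in_U])
qed

end

section \<open>Convergence of quantizations\<close>

context voronoi_quantizer
begin

abbreviation quantization :: "(real^'d) set \<Rightarrow> 'a \<Rightarrow> real^'d" where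
  "quantization \<equiv> voronoi_quantization C X"

lemma quantization_eq:
  assumes "finite \<Gamma>" "a \<in> \<Gamma>" "X \<omega> \<in> C \<Gamma> a"
  shows "quantization \<Gamma> \<omega> = a"
  using sum_indicator_cell[OF partition[OF assms(1,2)] assms, of "\<lambda>a. a"]
  by (simp add: voronoi_quantization_def)

lemma quantization_in_grid: "quantization (grid y) \<omega> \<in> grid y"
proof -
  obtain a where "a \<in> grid y" "X \<omega> \<in> C (grid y) a"
    using voronoi_owner[OF partition_grid] by metis
  then show ?thesis
    by (simp add: quantization_eq)
qed

lemma quantization_measurable: "quantization (grid y) \<in> borel_measurable M"
proof -
  have eq: "quantization (grid y) = (\<lambda>\<omega>. \<Sum>a\<in>grid y. indicat_real (C (grid y) a) (X \<omega>) *\<^sub>R a)"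
    by (rule ext) (rule voronoi_quantization_def)
  show ?thesis
    unfolding eq
    by (intro borel_measurable_sum borel_measurable_scaleR indicator_cell_measurable finite_grid
        borel_measurable_const)
qed

lemma norm_quantization_le: "norm (quantization (grid y) \<omega>) \<le> norm y"
  using quantization_in_grid[of y \<omega>] Finite_Cartesian_Product.norm_nth_le[of y]
  by (auto simp: grid_def)

text \<open>
  Several components of the tuples may converge to \<open>a\<close>, and the owner of \<open>X \<omega>\<close> may change among them
  forever; they all have the same limit.
\<close>
lemma quantization_tendsto:
  fixes y :: "nat \<Rightarrow> real^'d^'n"
  assumes lim: "y \<longlonglongrightarrow> l" and a: "a \<in> grid l"
    and strict: "\<And>b. b \<in> grid l \<Longrightarrow> b \<noteq> a \<Longrightarrow> norm (X \<omega> - a) < norm (X \<omega> - b)"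
  shows "(\<lambda>k. quantization (grid (y k)) \<omega>) \<longlonglongrightarrow> quantization (grid l) \<omega>"
proof -
  have "X \<omega> \<in> C (grid l) a"
    by (rule strictly_nearest_in_cell[OF partition_grid finite_grid a strict])
  then have limit: "quantization (grid l) \<omega> = a"
    using a by (intro quantization_eq) auto
  obtain i0 where i0: "l $ i0 = a"
    using a by (auto simp: grid_def)
  have lim_nth: "(\<lambda>k. y k $ i) \<longlonglongrightarrow> l $ i" for i
    using lim by (rule tendsto_vec_nth)
  show ?thesis
    unfolding limit
  proof (rule tendstoI)
    fix e :: real assume e: "e > 0"
    have "\<forall>\<^sub>F k in sequentially. \<forall>i\<in>UNIV. dist (y k $ i) (l $ i) < e"
      by (intro eventually_ball_finite ballI tendstoD lim_nth e) simp
    moreover have "\<forall>\<^sub>F k in sequentially. \<forall>i\<in>{i. l $ i \<noteq> a}.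
        0 < norm (X \<omega> - y k $ i) - norm (X \<omega> - y k $ i0)"
    proof (intro eventually_ball_finite ballI)
      fix i assume i: "i \<in> {i. l $ i \<noteq> a}"
      have "(\<lambda>k. norm (X \<omega> - y k $ i) - norm (X \<omega> - y k $ i0))
          \<longlonglongrightarrow> norm (X \<omega> - l $ i) - norm (X \<omega> - l $ i0)"
        by (intro tendsto_intros lim_nth)
      moreover have "0 < norm (X \<omega> - l $ i) - norm (X \<omega> - l $ i0)"
        using strict[of "l $ i"] i i0 by simp
      ultimately show "\<forall>\<^sub>F k in sequentially. 0 < norm (X \<omega> - y k $ i) - norm (X \<omega> - y k $ i0)"
        by (rule order_tendstoD(1))
    qed simp
    ultimately show "\<forall>\<^sub>F k in sequentially. dist (quantization (grid (y k)) \<omega>) a < e"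
    proof eventually_elim
      case (elim k)
      obtain b where b: "b \<in> grid (y k)" "X \<omega> \<in> C (grid (y k)) b"
        using voronoi_owner[OF partition_grid] by metis
      then obtain i where i: "b = y k $ i"
        by (auto simp: grid_def)
      have "norm (X \<omega> - b) \<le> norm (X \<omega> - y k $ i0)"
        by (rule voronoi_cell_nearest[OF partition_grid finite_grid b(1) nth_in_grid b(2)])
      then have "l $ i = a"
        using elim(2) i by force
      then show ?case
        using elim(1) i quantization_eq[OF finite_grid b] by auto
    qed
  qed
qed

lemma AE_quantization_tendsto:
  fixes y :: "nat \<Rightarrow> real^'d^'n"
  assumes lim: "y \<longlonglongrightarrow> l"
    and null: "\<P>(\<omega> in M. X \<omega> \<in> (\<Union>a\<in>grid l. frontier (C (grid l) a))) = 0"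
  shows "AE \<omega> in M. (\<lambda>k. quantization (grid (y k)) \<omega>) \<longlonglongrightarrow> quantization (grid l) \<omega>"
proof -
  have "(\<Union>a\<in>grid l. frontier (C (grid l) a)) \<in> sets borel"
    by (intro borel_closed closed_UN) auto
  then have "{\<omega>\<in>space M. X \<omega> \<in> (\<Union>a\<in>grid l. frontier (C (grid l) a))} \<in> events"
    by measurable
  then have "AE \<omega> in M. X \<omega> \<notin> (\<Union>a\<in>grid l. frontier (C (grid l) a))"
    using null prob_eq_0 by (auto elim: AE_mp)
  then show ?thesis
  proof eventually_elim
    case (elim \<omega>)
    obtain a where a: "a \<in> grid l" "X \<omega> \<in> C (grid l) a"
      using voronoi_owner[OF partition_grid] by metis
    show ?case
      using lim a(1)
    proof (rule quantization_tendsto)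
      fix b assume "b \<in> grid l" "b \<noteq> a"
      then show "norm (X \<omega> - a) < norm (X \<omega> - b)"
        using elim a by (intro interior_cell_strictly_nearest[OF partition_grid]) auto
    qed
  qed
qed

lemma L2_quantization_tendsto:
  fixes y :: "nat \<Rightarrow> real^'d^'n"
  assumes lim: "y \<longlonglongrightarrow> l"
    and AE: "AE \<omega> in M. (\<lambda>k. quantization (grid (y k)) \<omega>) \<longlonglongrightarrow> quantization (grid l) \<omega>"
  shows "(\<lambda>k. \<integral>\<^sup>+\<omega>. ennreal ((norm (quantization (grid (y k)) \<omega> - quantization (grid l) \<omega>))\<^sup>2) \<partial>M)
    \<longlonglongrightarrow> 0"
proof -
  let ?u = "\<lambda>k \<omega>. ennreal ((norm (quantization (grid (y k)) \<omega> - quantization (grid l) \<omega>))\<^sup>2)"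
  note [measurable] = quantization_measurable
  obtain B where B: "\<And>k. norm (y k) \<le> B"
    using convergent_imp_bounded[OF lim] by (auto simp: bounded_iff)
  have "(\<lambda>k. \<integral>\<^sup>+\<omega>. ?u k \<omega> \<partial>M) \<longlonglongrightarrow> (\<integral>\<^sup>+\<omega>. 0 \<partial>M)"
  proof (rule nn_integral_dominated_convergence[where w = "\<lambda>_. ennreal ((B + norm l)\<^sup>2)"])
    show "AE \<omega> in M. ?u k \<omega> \<le> ennreal ((B + norm l)\<^sup>2)" for k
    proof (intro AE_I2 ennreal_leI power_mono)
      fix \<omega>
      show "norm (quantization (grid (y k)) \<omega> - quantization (grid l) \<omega>) \<le> B + norm l"
        using norm_triangle_ineq4[of "quantization (grid (y k)) \<omega>" "quantization (grid l) \<omega>"]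
          norm_quantization_le[of "y k" \<omega>] norm_quantization_le[of l \<omega>] B[of k] by linarith
    qed simp
    show "AE \<omega> in M. (\<lambda>k. ?u k \<omega>) \<longlonglongrightarrow> 0"
      using AE
    proof eventually_elim
      case (elim \<omega>)
      have "(\<lambda>k. ?u k \<omega>) \<longlonglongrightarrow> ennreal ((norm (quantization (grid l) \<omega> - quantization (grid l) \<omega>))\<^sup>2)"
        by (intro tendsto_ennrealI tendsto_intros elim)
      then show ?case
        by simp
    qed
    show "(\<integral>\<^sup>+\<omega>. ennreal ((B + norm l)\<^sup>2) \<partial>M) < \<infinity>"
      by (simp add: emeasure_space_1)
  qed auto
  then show ?thesis
    by simp
qed

text \<open>
  Tested against functions \<open>h\<close> of the quantization, the residual \<open>X - quantization\<close> records the
  weighted Lloyd displacements. In this form stationarity passes to the limit even when several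
  points of the approximating grids merge, since \<open>h\<close> need not distinguish them.
\<close>
lemma expectation_weighted_residual:
  fixes h :: "real^'d \<Rightarrow> real"
  shows "(\<integral>\<omega>. h (quantization (grid y) \<omega>) *\<^sub>R (X \<omega> - quantization (grid y) \<omega>) \<partial>M)
    = (\<Sum>a\<in>grid y. (h a * cell_prob (grid y) a) *\<^sub>R (lloyd (grid y) a - a))"
proof -
  let ?G = "grid y"
  let ?I = "\<lambda>a \<omega>. indicat_real (C ?G a) (X \<omega>)"
  have point: "h (quantization ?G \<omega>) *\<^sub>R (X \<omega> - quantization ?G \<omega>)
      = (\<Sum>a\<in>?G. h a *\<^sub>R (?I a \<omega> *\<^sub>R X \<omega> - ?I a \<omega> *\<^sub>R a))" for \<omega>
  proof -
    obtain a where a: "a \<in> ?G" "X \<omega> \<in> C ?G a"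
      using voronoi_owner[OF partition_grid] by metis
    have "h a *\<^sub>R (X \<omega> - a) = (\<Sum>a\<in>?G. ?I a \<omega> *\<^sub>R (h a *\<^sub>R (X \<omega> - a)))"
      by (rule sum_indicator_cell[OF partition_grid finite_grid a, symmetric])
    then show ?thesis
      by (simp add: quantization_eq[OF finite_grid a] algebra_simps)
  qed
  have int: "integrable M (\<lambda>\<omega>. ?I a \<omega> *\<^sub>R X \<omega>)" "integrable M (\<lambda>\<omega>. ?I a \<omega> *\<^sub>R a)" if "a \<in> ?G" for a
    using that by (auto intro: indicator_cell_integrable X_integrable)
  have "(\<integral>\<omega>. h (quantization ?G \<omega>) *\<^sub>R (X \<omega> - quantization ?G \<omega>) \<partial>M)
      = (\<Sum>a\<in>?G. \<integral>\<omega>. h a *\<^sub>R (?I a \<omega> *\<^sub>R X \<omega> - ?I a \<omega> *\<^sub>R a) \<partial>M)"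
    unfolding point using int
    by (intro Bochner_Integration.integral_sum integrable_scaleR_right Bochner_Integration.integrable_diff)
  also have "\<dots> = (\<Sum>a\<in>?G. (h a * cell_prob ?G a) *\<^sub>R (lloyd ?G a - a))"
  proof (intro sum.cong refl)
    fix a assume a: "a \<in> ?G"
    have "(\<integral>\<omega>. h a *\<^sub>R (?I a \<omega> *\<^sub>R X \<omega> - ?I a \<omega> *\<^sub>R a) \<partial>M)
        = h a *\<^sub>R ((\<integral>\<omega>. ?I a \<omega> *\<^sub>R X \<omega> \<partial>M) - (\<integral>\<omega>. ?I a \<omega> *\<^sub>R a \<partial>M))"
      using int[OF a] by (subst integral_scaleR_right, subst Bochner_Integration.integral_diff) auto
    also have "(\<integral>\<omega>. ?I a \<omega> *\<^sub>R a \<partial>M) = cell_prob ?G a *\<^sub>R a"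
      using expectation_indicator_cell[OF finite_grid a]
      by (subst integral_scaleR_left) auto
    finally show "(\<integral>\<omega>. h a *\<^sub>R (?I a \<omega> *\<^sub>R X \<omega> - ?I a \<omega> *\<^sub>R a) \<partial>M)
        = (h a * cell_prob ?G a) *\<^sub>R (lloyd ?G a - a)"
      by (simp add: expectation_cell_eq_lloyd[OF finite_grid a] scaleR_diff_right)
  qed
  finally show ?thesis .
qed

end

section \<open>Differentiability of the distortion\<close>

lemma abs_MIN_diff_le:
  fixes a b :: "'i::finite \<Rightarrow> real"
  assumes "\<And>i. \<bar>a i - b i\<bar> \<le> c"
  shows "\<bar>(MIN i. a i) - (MIN i. b i)\<bar> \<le> c"
proof -
  have le: "(MIN i. a i) \<le> (MIN i. b i) + c" if ab: "\<And>i. \<bar>a i - b i\<bar> \<le> c" for a b :: "'i \<Rightarrow> real"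
  proof -
    have "(MIN i. b i) \<in> range b"
      by (intro Min_in) auto
    then obtain i where i: "(MIN i. b i) = b i"
      by (rule rangeE)
    have "(MIN i. a i) \<le> a i"
      by (intro Min_le) auto
    then show ?thesis
      using ab[of i] i by linarith
  qed
  show ?thesis
    using le[of a b] le[of b a] assms by (simp add: abs_minus_commute abs_le_iff)
qed

context voronoi_quantizer
begin

lemma AE_not_in_hyperplane:
  assumes "charges_no_hyperplane (distr M borel X)" "v \<noteq> 0"
  shows "AE \<omega> in M. v \<bullet> X \<omega> \<noteq> c"
proof -
  have "closed {\<xi>. v \<bullet> \<xi> = c}"
    by (rule closed_hyperplane)
  then have "{\<xi>. v \<bullet> \<xi> = c} \<in> null_sets (distr M borel X)"
    using assms by (auto simp: charges_no_hyperplane_def null_sets_def)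
  then have "AE \<xi> in distr M borel X. \<xi> \<notin> {\<xi>. v \<bullet> \<xi> = c}"
    by (rule AE_not_in)
  then have "AE \<omega> in M. X \<omega> \<notin> {\<xi>. v \<bullet> \<xi> = c}"
    by (rule AE_distrD[rotated]) simp
  then show ?thesis
    by simp
qed

lemma AE_not_equidistant:
  assumes "charges_no_hyperplane (distr M borel X)" "a \<noteq> b"
  shows "AE \<omega> in M. norm (X \<omega> - a) \<noteq> norm (X \<omega> - b)"
proof -
  have "2 *\<^sub>R (a - b) \<noteq> 0"
    using assms(2) by simp
  from AE_not_in_hyperplane[OF assms(1) this, of "a \<bullet> a - b \<bullet> b"] show ?thesis
  proof eventually_elim
    case (elim \<omega>)
    then show ?case
      using norm_diff_sq_bisector[of "X \<omega>" b a] by auto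
  qed
qed

text \<open>
  For almost every value of \<open>X\<close> the nearest point is unique, so it stays the nearest one under
  small perturbations of the grid and the squared distance is differentiable with an explicit
  remainder. The difference quotients are dominated by a multiple of the distances to the
  points plus a constant.
\<close>
lemma distortion_gderiv:
  fixes x :: "real^'d^'n"
  assumes nohyp: "charges_no_hyperplane (distr M borel X)" and inj: "inj (\<lambda>i. x $ i)"
  shows "GDERIV (distortion M X) x
    :> (\<chi> i. (2 * cell_prob (grid x) (x $ i)) *\<^sub>R (x $ i - lloyd (grid x) (x $ i)))"
    (is "GDERIV _ _ :> ?g")
proof -
  let ?G = "grid x"
  let ?\<phi> = "\<lambda>y \<xi>. MIN i. (norm (\<xi> - y $ i))\<^sup>2 :: real"
  let ?I = "\<lambda>i \<xi>. indicat_real (C ?G (x $ i)) \<xi>"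
  let ?D = "\<lambda>h \<xi>. \<Sum>i\<in>UNIV. ?I i \<xi> * ((- 2 *\<^sub>R (h $ i)) \<bullet> \<xi> - (- 2 *\<^sub>R (h $ i)) \<bullet> x $ i)"
  let ?R = "\<lambda>h \<xi>. ?\<phi> (x + h) \<xi> - ?\<phi> x \<xi> - ?D h \<xi>"
  define S where "S \<xi> = (\<Sum>i\<in>UNIV. norm (\<xi> - x $ i))" for \<xi>
  have intD: "integrable M (\<lambda>\<omega>. ?D h (X \<omega>))" for h :: "real^'d^'n"
    by (intro Bochner_Integration.integrable_sum expectation_cell_affine(1)) auto
  have ED: "(\<integral>\<omega>. ?D h (X \<omega>) \<partial>M) = h \<bullet> ?g" for h :: "real^'d^'n"
  proof -
    have "(\<integral>\<omega>. ?D h (X \<omega>) \<partial>M) = (\<Sum>i\<in>UNIV. cell_prob ?G (x $ i) *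
        ((- 2 *\<^sub>R (h $ i)) \<bullet> lloyd ?G (x $ i) - (- 2 *\<^sub>R (h $ i)) \<bullet> x $ i))"
      by (subst Bochner_Integration.integral_sum)
        (intro expectation_cell_affine(1) finite_grid nth_in_grid,
         intro sum.cong refl expectation_cell_affine(2) finite_grid nth_in_grid)
    also have "\<dots> = h \<bullet> ?g"
      unfolding inner_vec_def[of h]
      by (intro sum.cong refl) (simp add: inner_diff_right algebra_simps)
    finally show ?thesis .
  qed
  have ER: "(\<integral>\<omega>. ?R h (X \<omega>) \<partial>M) = distortion M X (x + h) - distortion M X x - h \<bullet> ?g" for h
    unfolding ED[symmetric] distortion_def
    by (simp only: Bochner_Integration.integral_diff Bochner_Integration.integrable_diff
        sq_distance_integrable intD)
  have S_ge: "norm (\<xi> - x $ i) \<le> S \<xi>" for \<xi> i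
    unfolding S_def by (rule member_le_sum) auto
  have expand: "(norm (\<xi> - (x + h) $ i))\<^sup>2 - (norm (\<xi> - x $ i))\<^sup>2
      = (norm (h $ i))\<^sup>2 - 2 * ((\<xi> - x $ i) \<bullet> h $ i)" for \<xi> h i
    by (simp add: power2_norm_eq_inner inner_diff_left inner_diff_right inner_add_left
        inner_add_right inner_commute)
  have R_bound: "\<bar>?R h \<xi>\<bar> \<le> norm h * (4 * S \<xi> + norm h)" for h \<xi>
  proof -
    have inner_le: "\<bar>(\<xi> - x $ i) \<bullet> h $ i\<bar> \<le> norm (\<xi> - x $ i) * norm h" for i
      using Cauchy_Schwarz_ineq2[of "\<xi> - x $ i" "h $ i"]
        mult_left_mono[OF Finite_Cartesian_Product.norm_nth_le[of h i], of "norm (\<xi> - x $ i)"]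
      by simp
    have "\<bar>?\<phi> (x + h) \<xi> - ?\<phi> x \<xi>\<bar> \<le> norm h * (2 * S \<xi> + norm h)"
    proof (rule abs_MIN_diff_le)
      fix i
      have "(norm (h $ i))\<^sup>2 \<le> norm h * norm h"
        using Finite_Cartesian_Product.norm_nth_le[of h i] unfolding power2_eq_square
        by (intro mult_mono) auto
      moreover have "\<bar>(\<xi> - x $ i) \<bullet> h $ i\<bar> \<le> S \<xi> * norm h"
        using inner_le[of i] mult_right_mono[OF S_ge[of \<xi> i], of "norm h"] by simp
      moreover have "norm h * (2 * S \<xi> + norm h) = 2 * (S \<xi> * norm h) + norm h * norm h"
        by (simp add: algebra_simps)
      ultimately show "\<bar>(norm (\<xi> - (x + h) $ i))\<^sup>2 - (norm (\<xi> - x $ i))\<^sup>2\<bar>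
          \<le> norm h * (2 * S \<xi> + norm h)"
        unfolding expand using zero_le_power2[of "norm (h $ i)"] by linarith
    qed
    moreover have "\<bar>?D h \<xi>\<bar> \<le> (\<Sum>i\<in>UNIV. 2 * (norm (\<xi> - x $ i) * norm h))"
    proof (intro order_trans[OF sum_abs] sum_mono)
      fix i
      have "\<bar>?I i \<xi> * ((- 2 *\<^sub>R (h $ i)) \<bullet> \<xi> - (- 2 *\<^sub>R (h $ i)) \<bullet> x $ i)\<bar>
          \<le> 2 * \<bar>(\<xi> - x $ i) \<bullet> h $ i\<bar>"
      proof -
        have "(- 2 *\<^sub>R (h $ i)) \<bullet> \<xi> - (- 2 *\<^sub>R (h $ i)) \<bullet> x $ i = - 2 * ((\<xi> - x $ i) \<bullet> h $ i)"
          by (simp add: inner_diff_left inner_diff_right inner_commute)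
        then show ?thesis
          by (simp only: abs_mult) (simp add: indicator_def)
      qed
      also have "\<dots> \<le> 2 * (norm (\<xi> - x $ i) * norm h)"
        using inner_le by simp
      finally show "\<bar>?I i \<xi> * ((- 2 *\<^sub>R (h $ i)) \<bullet> \<xi> - (- 2 *\<^sub>R (h $ i)) \<bullet> x $ i)\<bar>
          \<le> 2 * (norm (\<xi> - x $ i) * norm h)" .
    qed
    moreover have "(\<Sum>i\<in>UNIV. 2 * (norm (\<xi> - x $ i) * norm h)) = norm h * (2 * S \<xi>)"
      unfolding S_def sum_distrib_left by (intro sum.cong) auto
    ultimately show ?thesis
      by (simp add: distrib_left)
  qed
  have R_small: "\<forall>\<^sub>F n in sequentially. \<bar>?R (h n) \<xi>\<bar> \<le> (norm (h n))\<^sup>2"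
    if h: "h \<longlonglongrightarrow> 0" and uniq: "\<And>i j. i \<noteq> j \<Longrightarrow> norm (\<xi> - x $ i) \<noteq> norm (\<xi> - x $ j)" for h \<xi>
  proof -
    obtain a where a: "a \<in> ?G" "\<xi> \<in> C ?G a"
      using voronoi_owner[OF partition_grid] by metis
    then obtain j where j: "a = x $ j"
      by (auto simp: grid_def)
    have near: "norm (\<xi> - x $ j) < norm (\<xi> - x $ i)" if "i \<noteq> j" for i
      using voronoi_cell_nearest[OF partition_grid finite_grid a(1) nth_in_grid a(2), of i]
        uniq[OF that] j by simp
    have "\<forall>\<^sub>F n in sequentially. \<forall>i\<in>UNIV - {j}.
        0 < norm (\<xi> - (x + h n) $ i) - norm (\<xi> - (x + h n) $ j)"
    proof (intro eventually_ball_finite ballI)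
      fix i assume i: "i \<in> UNIV - {j}"
      have "(\<lambda>n. norm (\<xi> - (x + h n) $ i) - norm (\<xi> - (x + h n) $ j))
          \<longlonglongrightarrow> norm (\<xi> - (x + 0) $ i) - norm (\<xi> - (x + 0) $ j)"
        by (intro tendsto_intros h)
      then show "\<forall>\<^sub>F n in sequentially. 0 < norm (\<xi> - (x + h n) $ i) - norm (\<xi> - (x + h n) $ j)"
        using near[of i] i by (intro order_tendstoD(1)) auto
    qed simp
    then show ?thesis
    proof eventually_elim
      case (elim n)
      have "?\<phi> (x + h n) \<xi> = (norm (\<xi> - (x + h n) $ j))\<^sup>2"
      proof (rule Min_eqI)
        fix t assume "t \<in> range (\<lambda>i. (norm (\<xi> - (x + h n) $ i))\<^sup>2)"
        then obtain i where t: "t = (norm (\<xi> - (x + h n) $ i))\<^sup>2"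
          by auto
        show "(norm (\<xi> - (x + h n) $ j))\<^sup>2 \<le> t"
          unfolding t using bspec[OF elim, of i] by (cases "i = j") (auto intro!: power_mono)
      qed auto
      moreover have "?\<phi> x \<xi> = (norm (\<xi> - x $ j))\<^sup>2"
        using MIN_sq_eq[OF partition_grid a] j by simp
      moreover have "?D (h n) \<xi> = - 2 * ((\<xi> - x $ j) \<bullet> h n $ j)"
      proof -
        have "\<xi> \<notin> C ?G (x $ i)" if "i \<noteq> j" for i
          using voronoi_cell_nearest[OF partition_grid finite_grid _ a(1), of "x $ i" \<xi>]
            near[OF that] j by fastforce
        then have "?D (h n) \<xi> = (\<Sum>i\<in>UNIV. if i = j then - 2 * ((\<xi> - x $ j) \<bullet> h n $ j) else 0)"
          using a j by (intro sum.cong) (auto simp: inner_diff_left inner_diff_right inner_commute)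
        then show ?thesis
          by simp
      qed
      ultimately have "?R (h n) \<xi> = (norm (h n $ j))\<^sup>2"
        using expand[of \<xi> "h n" j] by simp
      also have "\<bar>\<dots>\<bar> \<le> (norm (h n))\<^sup>2"
        using Finite_Cartesian_Product.norm_nth_le[of "h n" j] by (auto intro: power_mono)
      finally show ?case .
    qed
  qed
  have AE_uniq: "AE \<omega> in M. \<forall>ij\<in>{ij :: 'n \<times> 'n. fst ij \<noteq> snd ij}.
      norm (X \<omega> - x $ fst ij) \<noteq> norm (X \<omega> - x $ snd ij)"
    using AE_not_equidistant[OF nohyp] inj by (intro AE_finite_allI) (auto simp: inj_eq)
  have "(\<lambda>h. norm (distortion M X (x + h) - distortion M X x - h \<bullet> ?g) / norm h) \<midarrow>0\<rightarrow> 0"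
    unfolding tendsto_at_iff_sequentially
  proof (intro allI impI)
    fix h :: "nat \<Rightarrow> real^'d^'n"
    assume "\<forall>n. h n \<in> UNIV - {0}" and h: "h \<longlonglongrightarrow> 0"
    then have h0: "h n \<noteq> 0" for n
      by auto
    obtain B where B: "\<And>n. norm (h n) \<le> B"
      using convergent_imp_bounded[OF h] by (auto simp: bounded_iff)
    have "(\<lambda>n. \<integral>\<omega>. ?R (h n) (X \<omega>) / norm (h n) \<partial>M) \<longlonglongrightarrow> (\<integral>\<omega>. 0 \<partial>M)"
    proof (rule integral_dominated_convergence[where w = "\<lambda>\<omega>. 4 * S (X \<omega>) + B"])
      show "integrable M (\<lambda>\<omega>. 4 * S (X \<omega>) + B)"
        unfolding S_def using X_integrable by auto
      show "(\<lambda>\<omega>. ?R (h n) (X \<omega>) / norm (h n)) \<in> borel_measurable M" for n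
        by (intro borel_measurable_divide borel_measurable_diff
            borel_measurable_integrable[OF sq_distance_integrable]
            borel_measurable_integrable[OF intD]) auto
      show "AE \<omega> in M. norm (?R (h n) (X \<omega>) / norm (h n)) \<le> 4 * S (X \<omega>) + B" for n
      proof (intro AE_I2)
        fix \<omega>
        have "\<bar>?R (h n) (X \<omega>)\<bar> \<le> norm (h n) * (4 * S (X \<omega>) + B)"
          using R_bound[of "X \<omega>" "h n"] mult_left_mono[OF B[of n], of "norm (h n)"]
          by (simp add: distrib_left)
        then show "norm (?R (h n) (X \<omega>) / norm (h n)) \<le> 4 * S (X \<omega>) + B"
          using h0[of n] by (simp add: pos_divide_le_eq mult.commute)
      qed
      show "AE \<omega> in M. (\<lambda>n. ?R (h n) (X \<omega>) / norm (h n)) \<longlonglongrightarrow> 0"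
        using AE_uniq
      proof eventually_elim
        case (elim \<omega>)
        show ?case
        proof (rule Lim_null_comparison)
          have "\<forall>\<^sub>F n in sequentially. \<bar>?R (h n) (X \<omega>)\<bar> \<le> (norm (h n))\<^sup>2"
            using elim by (intro R_small h) auto
          then show "\<forall>\<^sub>F n in sequentially. norm (?R (h n) (X \<omega>) / norm (h n)) \<le> norm (h n)"
            by eventually_elim (use h0 in \<open>simp add: pos_divide_le_eq power2_eq_square\<close>)
          show "(\<lambda>n. norm (h n)) \<longlonglongrightarrow> 0"
            using tendsto_norm[OF h] by simp
        qed
      qed
    qed simp
    then have "(\<lambda>n. \<bar>(distortion M X (x + h n) - distortion M X x - h n \<bullet> ?g) / norm (h n)\<bar>) \<longlonglongrightarrow> 0"
      unfolding integral_divide_zero ER by (intro tendsto_rabs_zero) simp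
    then show "((\<lambda>h. norm (distortion M X (x + h) - distortion M X x - h \<bullet> ?g) / norm h) \<circ> h) \<longlonglongrightarrow> 0"
      by (simp add: o_def)
  qed
  then show ?thesis
    unfolding gderiv_def has_derivative_at
    by (auto intro: bounded_linear_inner_left)
qed

end

section \<open>Stationarity of limiting grids and decay of gradients\<close>

context lloyd_sequence
begin

text \<open>
  Test the residual against a continuous function that singles out the point \<open>a\<close> of the limiting
  grid. Along the sequence the tested residual is bounded by the weighted steps and tends to \<open>0\<close>; in
  the limit it is the weighted Lloyd displacement of \<open>a\<close>.
\<close>
lemma limiting_grid_stationary:
  assumes r: "strict_mono r" "(\<lambda>n. x (r n)) \<longlonglongrightarrow> l"
    and null: "\<P>(\<omega> in M. X \<omega> \<in> (\<Union>a\<in>grid l. frontier (C (grid l) a))) = 0"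
  shows "stationary_grid C M X (grid l)"
  unfolding stationary_grid_def
proof
  fix a assume a: "a \<in> grid l"
  obtain d where d: "d > 0" "\<And>b. b \<in> grid l \<Longrightarrow> b \<noteq> a \<Longrightarrow> d \<le> dist a b"
    using finite_set_avoid[OF finite_grid[of l], of a] by blast
  \<comment> \<open>A continuous function that is \<open>1\<close> at \<open>a\<close> and \<open>0\<close> at the other points of the limiting grid.\<close>
  define h where "h y = max 0 (1 - dist y a / d)" for y
  have h: "h a = 1" "\<And>b. b \<in> grid l \<Longrightarrow> b \<noteq> a \<Longrightarrow> h b = 0" "\<And>y. 0 \<le> h y" "\<And>y. h y \<le> 1"
    using d by (auto simp: h_def dist_commute)
  let ?q = "\<lambda>n. quantization (grid (x (r n)))" and ?ql = "quantization (grid l)"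
  note [measurable] = quantization_measurable
  have h_meas [measurable]: "h \<in> borel_measurable borel"
    unfolding h_def by measurable
  obtain B where B: "\<And>k. norm (x k) \<le> B"
    using bounded_sequence by (auto simp: bounded_iff)
  have "(\<lambda>n. \<integral>\<omega>. h (?q n \<omega>) *\<^sub>R (X \<omega> - ?q n \<omega>) \<partial>M) \<longlonglongrightarrow> (\<integral>\<omega>. h (?ql \<omega>) *\<^sub>R (X \<omega> - ?ql \<omega>) \<partial>M)"
  proof (rule integral_dominated_convergence[where w = "\<lambda>\<omega>. norm (X \<omega>) + B"])
    show "integrable M (\<lambda>\<omega>. norm (X \<omega>) + B)"
      using X_integrable by auto
    show "AE \<omega> in M. (\<lambda>n. h (?q n \<omega>) *\<^sub>R (X \<omega> - ?q n \<omega>)) \<longlonglongrightarrow> h (?ql \<omega>) *\<^sub>R (X \<omega> - ?ql \<omega>)"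
      using AE_quantization_tendsto[OF r(2) null]
      by eventually_elim (unfold h_def, intro tendsto_intros, use d(1) in auto)
    show "AE \<omega> in M. norm (h (?q n \<omega>) *\<^sub>R (X \<omega> - ?q n \<omega>)) \<le> norm (X \<omega>) + B" for n
    proof (intro AE_I2)
      fix \<omega>
      have "norm (h (?q n \<omega>) *\<^sub>R (X \<omega> - ?q n \<omega>)) \<le> 1 * norm (X \<omega> - ?q n \<omega>)"
        using h(3,4)[of "?q n \<omega>"] by (auto intro!: mult_left_le_one_le)
      also have "\<dots> \<le> norm (X \<omega>) + B"
        using norm_triangle_ineq4[of "X \<omega>" "?q n \<omega>"] norm_quantization_le[of "x (r n)" \<omega>] B[of "r n"]
        by linarith
      finally show "norm (h (?q n \<omega>) *\<^sub>R (X \<omega> - ?q n \<omega>)) \<le> norm (X \<omega>) + B" .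
    qed
  qed auto
  moreover have "(\<lambda>n. \<integral>\<omega>. h (?q n \<omega>) *\<^sub>R (X \<omega> - ?q n \<omega>) \<partial>M) \<longlonglongrightarrow> 0"
  proof (rule Lim_null_comparison)
    let ?W = "\<lambda>k i. norm (mass k i *\<^sub>R (x (Suc k) $ i - x k $ i))"
    have "norm (\<integral>\<omega>. h (quantization (grid (x k)) \<omega>) *\<^sub>R (X \<omega> - quantization (grid (x k)) \<omega>) \<partial>M)
        \<le> (\<Sum>i\<in>UNIV. ?W k i)" for k
    proof -
      let ?G = "grid (x k)"
      let ?w = "\<lambda>b. norm (cell_prob ?G b *\<^sub>R (lloyd ?G b - b))"
      have "norm (\<integral>\<omega>. h (quantization ?G \<omega>) *\<^sub>R (X \<omega> - quantization ?G \<omega>) \<partial>M)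
          \<le> (\<Sum>b\<in>?G. norm ((h b * cell_prob ?G b) *\<^sub>R (lloyd ?G b - b)))"
        unfolding expectation_weighted_residual by (rule norm_sum)
      also have "\<dots> \<le> (\<Sum>b\<in>?G. ?w b)"
        using h(3,4) by (intro sum_mono) (auto simp: abs_mult mult.assoc intro!: mult_left_le_one_le)
      also have "\<dots> = sum ?w ((\<lambda>i. x k $ i) ` UNIV)"
        by (simp add: grid_def)
      also have "\<dots> \<le> sum (?w \<circ> (\<lambda>i. x k $ i)) UNIV"
        by (rule sum_image_le) auto
      also have "\<dots> = (\<Sum>i\<in>UNIV. ?W k i)"
        by (simp add: step)
      finally show ?thesis .
    qed
    then show "\<forall>\<^sub>F n in sequentially.
        norm (\<integral>\<omega>. h (?q n \<omega>) *\<^sub>R (X \<omega> - ?q n \<omega>) \<partial>M) \<le> (\<Sum>i\<in>UNIV. ?W (r n) i)"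
      by simp
    have "(\<lambda>n. ?W (r n) i) \<longlonglongrightarrow> 0" for i
      using LIMSEQ_subseq_LIMSEQ[OF tendsto_norm_zero[OF weighted_steps_tendsto_0[of i]] r(1)]
      by (simp only: o_def)
    then show "(\<lambda>n. \<Sum>i\<in>UNIV. ?W (r n) i) \<longlonglongrightarrow> 0"
      by (intro tendsto_null_sum)
  qed
  ultimately have "(\<integral>\<omega>. h (?ql \<omega>) *\<^sub>R (X \<omega> - ?ql \<omega>) \<partial>M) = 0"
    by (rule LIMSEQ_unique)
  moreover have "(\<integral>\<omega>. h (?ql \<omega>) *\<^sub>R (X \<omega> - ?ql \<omega>) \<partial>M)
      = (\<Sum>b\<in>grid l. if b = a then cell_prob (grid l) a *\<^sub>R (lloyd (grid l) a - a) else 0)"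
    unfolding expectation_weighted_residual using h(1,2) by (intro sum.cong) auto
  ultimately have "cell_prob (grid l) a *\<^sub>R (lloyd (grid l) a - a) = 0"
    using a by simp
  then show "lloyd (grid l) a = a"
    by (auto simp: lloyd_point_def split: if_splits)
qed

lemma distinct_if_no_hyperplane_charged:
  assumes nohyp: "charges_no_hyperplane (distr M borel X)" and init: "inj (\<lambda>i. x 0 $ i)"
  shows "inj (\<lambda>i. x k $ i)"
proof (rule distinct_preserved[OF init])
  fix k i j assume neq: "x k $ i \<noteq> x k $ j" and pos: "mass k i > 0"
  have "mass k i = \<P>(\<omega> in M. X \<omega> \<in> C (grid (x k)) (x k $ i) \<and>
      norm (X \<omega> - x k $ i) < norm (X \<omega> - x k $ j))"
  proof (rule finite_measure_eq_AE)
    show "AE \<omega> in M. \<omega> \<in> {\<omega>\<in>space M. X \<omega> \<in> C (grid (x k)) (x k $ i)} \<longleftrightarrow>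
        \<omega> \<in> {\<omega>\<in>space M. X \<omega> \<in> C (grid (x k)) (x k $ i) \<and>
          norm (X \<omega> - x k $ i) < norm (X \<omega> - x k $ j)}"
      using AE_not_equidistant[OF nohyp neq]
    proof eventually_elim
      case (elim \<omega>)
      then show ?case
        using voronoi_cell_nearest[OF partition_grid finite_grid nth_in_grid nth_in_grid,
            of "X \<omega>" "x k" i j] by auto
    qed
  qed (use cell_borel[of "grid (x k)" "x k $ i"] in measurable)
  with pos show "\<P>(\<omega> in M. X \<omega> \<in> C (grid (x k)) (x k $ i) \<and>
      norm (X \<omega> - x k $ i) < norm (X \<omega> - x k $ j)) > 0"
    by simp
qed

text \<open>
  Up to the factor \<open>-2\<close>, the components of the gradients are the weighted steps.
\<close>
lemma gradients_tendsto_0: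
  assumes nohyp: "charges_no_hyperplane (distr M borel X)" and init: "inj (\<lambda>i. x 0 $ i)"
  shows "\<exists>g. (\<forall>k. GDERIV (distortion M X) (x k) :> g k) \<and> g \<longlonglongrightarrow> 0"
proof (intro exI conjI allI)
  let ?g = "\<lambda>k. (\<chi> i. (2 * mass k i) *\<^sub>R (x k $ i - lloyd (grid (x k)) (x k $ i))) :: real^'d^'n"
  show "GDERIV (distortion M X) (x k) :> ?g k" for k
    by (rule distortion_gderiv[OF nohyp distinct_if_no_hyperplane_charged[OF nohyp init]])
  show "?g \<longlonglongrightarrow> 0"
  proof (rule vec_tendstoI)
    fix i
    have "(\<lambda>k. - 2 *\<^sub>R (mass k i *\<^sub>R (x (Suc k) $ i - x k $ i))) \<longlonglongrightarrow> - 2 *\<^sub>R 0"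
      by (intro tendsto_intros weighted_steps_tendsto_0)
    then show "(\<lambda>k. ?g k $ i) \<longlonglongrightarrow> 0 $ i"
      by (simp add: step algebra_simps)
  qed
qed

end

section \<open>Asymptotics of the Lloyd iterates\<close>

theorem proposition2p2:
  fixes M :: "'a measure"
    and X :: "'a \<Rightarrow> real^'d"
    and U \<Gamma>0 :: "(real^'d) set"
    and C :: "(real^'d) set \<Rightarrow> real^'d \<Rightarrow> (real^'d) set"
    and \<Gamma> :: "nat \<Rightarrow> (real^'d) set"
    and x :: "nat \<Rightarrow> real^'d^'n"
    and \<mu> :: "(real^'d) measure"
  assumes "prob_space M"
    and "X \<in> borel_measurable M"
    and "integrable M (\<lambda>\<omega>. (norm (X \<omega>))\<^sup>2)"
    and "\<mu> = distr M borel X"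
    and "closed U" and "convex U" and "interior U \<noteq> {}"
    and "measure_support \<mu> \<subseteq> U"
    and "voronoi_choice C"
    and "finite \<Gamma>0" and "card \<Gamma>0 = CARD('n)" and "\<Gamma>0 \<subseteq> U"
    and "\<Gamma> = (\<lambda>k. (lloyd_map C M X ^^ k) \<Gamma>0)"
    and "consistent_representation C M X \<Gamma> x"
    and "\<exists>K. compact K \<and> (\<forall>k. \<Gamma> k \<subseteq> K)"
  shows
    "(charges_no_hyperplane \<mu> \<and> measure_support \<mu> = U \<longrightarrow>
        liminf (\<lambda>k. INF (i, j)\<in>{(i, j). i \<noteq> j}. ereal (norm (x k $ i - x k $ j))) > 0)
     \<and>
     (\<forall>G. limiting_grid x G \<and> \<P>(\<omega> in M. X \<omega> \<in> (\<Union>a\<in>G. frontier (C G a))) = 0 \<longrightarrow>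
        stationary_grid C M X G \<and>
        (\<forall>\<phi>. strict_mono \<phi> \<and> grid_limit (x \<circ> \<phi>) G \<longrightarrow>
           (AE \<omega> in M. (\<lambda>k. voronoi_quantization C X (\<Gamma> (\<phi> k)) \<omega>)
                          \<longlonglongrightarrow> voronoi_quantization C X G \<omega>) \<and>
           (\<lambda>k. \<integral>\<^sup>+\<omega>. ennreal ((norm (voronoi_quantization C X (\<Gamma> (\<phi> k)) \<omega>
                                        - voronoi_quantization C X G \<omega>))\<^sup>2) \<partial>M) \<longlonglongrightarrow> 0))
     \<and>
     (charges_no_hyperplane \<mu> \<longrightarrow>
        (\<exists>g. (\<forall>k. GDERIV (distortion M X) (x k) :> g k) \<and> g \<longlonglongrightarrow> 0))
     \<and>
     (convex (measure_support \<mu>) \<and> U = measure_support \<mu> \<longrightarrow>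
        summable (\<lambda>k. (norm (x (Suc k) - x k))\<^sup>2) \<and>
        (\<lambda>k. x (Suc k) - x k) \<longlonglongrightarrow> 0 \<and>
        compact (subseq_limits x) \<and> connected (subseq_limits x) \<and>
        subseq_limits x \<subseteq> {y. \<forall>i. y $ i \<in> U})"
proof -
  interpret prob_space M
    by fact
  interpret voronoi_quantizer M X C
    by unfold_locales fact+
  have grid: "\<Gamma> k = grid (x k)" and lloyd_step: "x (Suc k) $ i = lloyd_point C M X (grid (x k)) (x k $ i)"
    for k i
    using \<open>consistent_representation C M X \<Gamma> x\<close> by (auto simp: consistent_representation_def)
  obtain K where K: "compact K" "\<And>k. \<Gamma> k \<subseteq> K"
    using \<open>\<exists>K. compact K \<and> (\<forall>k. \<Gamma> k \<subseteq> K)\<close> by blast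
  obtain B where B: "\<And>y. y \<in> K \<Longrightarrow> norm y \<le> B"
    using compact_imp_bounded[OF K(1)] by (auto simp: bounded_iff)
  have "x k $ i \<in> K" for k i
    using K(2)[of k] nth_in_grid[of "x k" i] unfolding grid by blast
  then have "norm (x k) \<le> real CARD('n) * B" for k
    by (intro norm_vec_le_card B)
  then have "bounded (range x)"
    by (auto simp: bounded_iff)
  then interpret lloyd_sequence M X C x
    using lloyd_step by unfold_locales
  have init: "grid (x 0) = \<Gamma>0"
    using grid[of 0] by (simp add: \<open>\<Gamma> = _\<close>)
  have init_distinct: "inj (\<lambda>i. x 0 $ i)"
    using \<open>card \<Gamma>0 = CARD('n)\<close> unfolding init[symmetric] grid_def
    by (intro eq_card_imp_inj_on) auto
  have full: "lloyd_in_full_support M X C x U" if "measure_support \<mu> = U"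
  proof unfold_locales
    show "x 0 $ i \<in> U" for i
      using \<open>\<Gamma>0 \<subseteq> U\<close> unfolding init[symmetric] by auto
    show "measure_support (distr M borel X) = U"
      using that \<open>\<mu> = _\<close> by simp
  qed (fact init_distinct \<open>closed U\<close> \<open>convex U\<close> \<open>interior U \<noteq> {}\<close>)+
  show ?thesis
  proof (intro conjI impI allI; (elim conjE)?)
    assume "measure_support \<mu> = U"
    then interpret lloyd_in_full_support M X C x U
      by (rule full)
    obtain \<delta> where \<delta>: "\<delta> > 0"
      "\<forall>\<^sub>F k in sequentially. \<forall>i j. i \<noteq> j \<longrightarrow> \<delta> \<le> norm (x k $ i - x k $ j)"
      using points_stay_apart by blast
    from \<delta>(2) have "\<forall>\<^sub>F k in sequentially.
        ereal \<delta> \<le> (INF (i, j)\<in>{(i, j). i \<noteq> j}. ereal (norm (x k $ i - x k $ j)))"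
      by eventually_elim (auto intro!: INF_greatest)
    then have "ereal \<delta> \<le> liminf (\<lambda>k. INF (i, j)\<in>{(i, j). i \<noteq> j}. ereal (norm (x k $ i - x k $ j)))"
      by (rule Liminf_bounded)
    moreover have "0 < ereal \<delta>"
      using \<delta>(1) by simp
    ultimately show "0 < liminf (\<lambda>k. INF (i, j)\<in>{(i, j). i \<noteq> j}. ereal (norm (x k $ i - x k $ j)))"
      by (rule order_less_le_trans[rotated])
  next
    fix G assume "limiting_grid x G"
      and null: "\<P>(\<omega> in M. X \<omega> \<in> (\<Union>a\<in>G. frontier (C G a))) = 0"
    then obtain r l where "strict_mono r" "(\<lambda>n. x (r n)) \<longlonglongrightarrow> l" "G = grid l"
      by (auto simp: limiting_grid_def grid_limit_def o_def)
    then show "stationary_grid C M X G"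
      using limiting_grid_stationary null by blast
  next
    fix G and \<phi> :: "nat \<Rightarrow> nat"
    assume null: "\<P>(\<omega> in M. X \<omega> \<in> (\<Union>a\<in>G. frontier (C G a))) = 0" and "grid_limit (x \<circ> \<phi>) G"
    then obtain l where l: "(\<lambda>k. x (\<phi> k)) \<longlonglongrightarrow> l" "G = grid l"
      by (auto simp: grid_limit_def o_def)
    show AE: "AE \<omega> in M. (\<lambda>k. voronoi_quantization C X (\<Gamma> (\<phi> k)) \<omega>)
        \<longlonglongrightarrow> voronoi_quantization C X G \<omega>"
      using AE_quantization_tendsto[OF l(1)] null unfolding l(2) grid by blast
    show "(\<lambda>k. \<integral>\<^sup>+\<omega>. ennreal ((norm (voronoi_quantization C X (\<Gamma> (\<phi> k)) \<omega>
        - voronoi_quantization C X G \<omega>))\<^sup>2) \<partial>M) \<longlonglongrightarrow> 0"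
      using L2_quantization_tendsto[OF l(1)] AE unfolding l(2) grid by blast
  next
    assume "charges_no_hyperplane \<mu>"
    then show "\<exists>g. (\<forall>k. GDERIV (distortion M X) (x k) :> g k) \<and> g \<longlonglongrightarrow> 0"
      using gradients_tendsto_0 init_distinct \<open>\<mu> = _\<close> by simp
  next
    assume "U = measure_support \<mu>"
    then interpret lloyd_in_full_support M X C x U
      using full by simp
    show "summable (\<lambda>k. (norm (x (Suc k) - x k))\<^sup>2)" "(\<lambda>k. x (Suc k) - x k) \<longlonglongrightarrow> 0"
      "compact (subseq_limits x)" "connected (subseq_limits x)"
      "subseq_limits x \<subseteq> {y. \<forall>i. y $ i \<in> U}"
      by (fact summable_steps steps_tendsto_0 compact_subseq_limits[OF bounded_sequence]
          connected_subseq_limits[OF bounded_sequence steps_tendsto_0] subseq_limits_in_U)+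
  qed
qed

end
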